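(* Let $G$ be a non-trivial countable amenable discrete group, and let $(v_j)_{j\in\mathbb{N}}$ be a product sequence in $Z^2(G,\mathbb{T})$. Then there exist a subsequence $(u_i)$ of $(v_j)$ and a sequence $\phi=(\phi_i)$ of unit vectors in $\ell^2(G)$ such that $\otimes_i\lambda_{u_i}$ exists on $\mathcal{H}^\phi=\bigotimes_i^{\phi}\ell^2(G)$.
   Context: $Z^2(G,\mathbb{T})$ is the set of normalized 2-cocycles, i.e. maps $u:G\times G\to\mathbb{T}$ (circle group) with $u(x,y)u(xy,z)=u(y,z)u(x,yz)$ and $u(x,e)=u(e,x)=1$. An infinite product $\prod_iz_i$ of complex numbers exists if the net of finite products $\prod_{i\in J}z_i$, indexed by the finite non-empty $J\subset\mathbb{N}$ ordered by inclusion, converges. A sequence $(u_i)$ in $Z^2(G,\mathbb{T})$ is a product sequence if the pointwise infinite product $\prod_iu_i$ exists on $G\times G$. For $u\in Z^2(G,\mathbb{T})$, the left $u$-regular projective unitary representation $\lambda_u$ on $\ell^2(G)$ is $(\lambda_u(x)f)(y)=u(y^{-1},x)f(x^{-1}y)$. Infinite tensor products: for Hilbert spaces $\mathcal{H}_i$ and unit vectors $\phi_i\in\mathcal{H}_i$, $\phi=(\phi_i)$, the space $\mathcal{H}^\phi=\bigotimes_i^{\phi}\mathcal{H}_i$ is the completed inductive limit of the spaces $\mathcal{H}_1\otimes\cdots\otimes\mathcal{H}_n$ under the isometries $\psi\mapsto\psi\otimes\phi_{n+1}$. For bounded operators $T_i$ on $\mathcal{H}_i$ and a finite non-empty $J\subset\mathbb{N}$,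 let $\tilde T_J$ be the bounded operator on $\mathcal{H}^\phi$ acting as $T_i$ in the factors $i\in J$ and as the identity in the others. One says that $\otimes_iT_i$ exists on $\mathcal{H}^\phi$ if the net $(\tilde T_J)_J$ (indexed by finite non-empty subsets of $\mathbb{N}$ ordered by inclusion) converges in the strong operator topology to a bounded operator, which is then denoted $\otimes_iT_i$. "$\otimes_i\lambda_{u_i}$ exists" means $\otimes_i\lambda_{u_i}(x)$ exists for every $x\in G$. *)

theory Defs
  imports "HOL-Analysis.Analysis" "HOL-Algebra.Group"
begin

section \<open>Amenability, 2-cocycles and projective regular representations\<close>

text \<open>Existence of a left-invariant mean on the bounded real functions. A function
  on the group is a function on the whole type of which only the values on the carrier
  matter: by the positivity clause, \<open>m f\<close> does not depend on the others.\<close>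

definition amenable :: "('g, 'b) monoid_scheme \<Rightarrow> bool" where
  "amenable G \<longleftrightarrow> (\<exists>m :: ('g \<Rightarrow> real) \<Rightarrow> real.
     (\<forall>f g. bounded (f ` carrier G) \<longrightarrow> bounded (g ` carrier G) \<longrightarrow>
        m (\<lambda>y. f y + g y) = m f + m g) \<and>
     (\<forall>c f. bounded (f ` carrier G) \<longrightarrow> m (\<lambda>y. c * f y) = c * m f) \<and>
     (\<forall>f. bounded (f ` carrier G) \<longrightarrow> (\<forall>y\<in>carrier G. 0 \<le> f y) \<longrightarrow> 0 \<le> m f) \<and>
     m (\<lambda>y. 1) = 1 \<and>
     (\<forall>x\<in>carrier G. \<forall>f. bounded (f ` carrier G) \<longrightarrow>
        m (\<lambda>y. f (inv\<^bsub>G\<^esub> x \<otimes>\<^bsub>G\<^esub> y)) = m f))"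

definition cocycles2 :: "('g, 'b) monoid_scheme \<Rightarrow> ('g \<Rightarrow> 'g \<Rightarrow> complex) set" where
  "cocycles2 G = {u.
     (\<forall>x\<in>carrier G. \<forall>y\<in>carrier G. cmod (u x y) = 1) \<and>
     (\<forall>x\<in>carrier G. \<forall>y\<in>carrier G. \<forall>z\<in>carrier G.
        u x y * u (x \<otimes>\<^bsub>G\<^esub> y) z = u y z * u x (y \<otimes>\<^bsub>G\<^esub> z)) \<and>
     (\<forall>x\<in>carrier G. u x \<one>\<^bsub>G\<^esub> = 1 \<and> u \<one>\<^bsub>G\<^esub> x = 1)}"

definition product_sequence ::
    "('g, 'b) monoid_scheme \<Rightarrow> (nat \<Rightarrow> 'g \<Rightarrow> 'g \<Rightarrow> complex) \<Rightarrow> bool" where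
  "product_sequence G u \<longleftrightarrow>
     (\<forall>i. u i \<in> cocycles2 G) \<and>
     (\<forall>x\<in>carrier G. \<forall>y\<in>carrier G.
        \<exists>L. ((\<lambda>J. \<Prod>i\<in>J. u i x y) \<longlongrightarrow> L) (finite_subsets_at_top UNIV))"

text \<open>\<open>\<ell>\<^sup>2(A)\<close>: square summable functions on \<open>A\<close>, extended by zero outside \<open>A\<close>.\<close>

definition ell2 :: "'a set \<Rightarrow> ('a \<Rightarrow> complex) set" where
  "ell2 A = {f. (\<lambda>x. (cmod (f x))\<^sup>2) summable_on A \<and> (\<forall>x. x \<notin> A \<longrightarrow> f x = 0)}"

definition ell2_norm :: "'a set \<Rightarrow> ('a \<Rightarrow> complex) \<Rightarrow> real" where
  "ell2_norm A f = sqrt (\<Sum>\<^sub>\<infinity>x\<in>A. (cmod (f x))\<^sup>2)"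

definition left_regular ::
    "('g, 'b) monoid_scheme \<Rightarrow> ('g \<Rightarrow> 'g \<Rightarrow> complex) \<Rightarrow> 'g \<Rightarrow> ('g \<Rightarrow> complex) \<Rightarrow> 'g \<Rightarrow> complex" where
  "left_regular G u x f =
     (\<lambda>y. if y \<in> carrier G then u (inv\<^bsub>G\<^esub> y) x * f (inv\<^bsub>G\<^esub> x \<otimes>\<^bsub>G\<^esub> y) else 0)"

section \<open>The infinite tensor product of copies of \<open>\<ell>\<^sup>2(X)\<close> along unit vectors \<open>\<phi> i\<close>\<close>

text \<open>The Hilbert space tensor product of \<open>n\<close> copies of \<open>\<ell>\<^sup>2(X)\<close> is realised as
  \<open>\<ell>\<^sup>2(X\<^sup>n)\<close>, with \<open>f\<^sub>0 \<otimes> \<dots> \<otimes> f\<^sub>n\<^sub>-\<^sub>1\<close> being the function \<open>y \<mapsto> f\<^sub>0 (y 0) \<cdots> f\<^sub>n\<^sub>-\<^sub>1 (y (n - 1))\<close>.\<close>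

definition cube :: "'a set \<Rightarrow> nat \<Rightarrow> (nat \<Rightarrow> 'a) set" where
  "cube X n = {..<n} \<rightarrow>\<^sub>E X"

definition tensor_vec ::
    "'a set \<Rightarrow> nat \<Rightarrow> ((nat \<Rightarrow> 'a) \<Rightarrow> complex) \<Rightarrow> ('a \<Rightarrow> complex) \<Rightarrow> (nat \<Rightarrow> 'a) \<Rightarrow> complex" where
  "tensor_vec X n \<psi> f =
     (\<lambda>y. if y \<in> cube X (Suc n) then \<psi> (restrict y {..<n}) * f (y n) else 0)"

text \<open>The connecting isometry \<open>\<psi> \<mapsto> \<psi> \<otimes> \<phi>\<^sub>n \<otimes> \<dots> \<otimes> \<phi>\<^sub>n\<^sub>+\<^sub>k\<^sub>-\<^sub>1\<close> from \<open>\<ell>\<^sup>2(X\<^sup>n)\<close> to \<open>\<ell>\<^sup>2(X\<^sup>n\<^sup>+\<^sup>k)\<close>.\<close>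

primrec embed ::
    "'a set \<Rightarrow> (nat \<Rightarrow> 'a \<Rightarrow> complex) \<Rightarrow> nat \<Rightarrow> nat \<Rightarrow> ((nat \<Rightarrow> 'a) \<Rightarrow> complex) \<Rightarrow> (nat \<Rightarrow> 'a) \<Rightarrow> complex" where
  "embed X \<phi> n 0 \<psi> = \<psi>"
| "embed X \<phi> n (Suc k) \<psi> = tensor_vec X (n + k) (embed X \<phi> n k \<psi>) (\<phi> (n + k))"

text \<open>The completed inductive limit of the spaces \<open>\<ell>\<^sup>2(X\<^sup>n)\<close>. Since they increase to a dense
  subspace, every vector of the completion is the limit of a sequence whose \<open>n\<close>-th term lies
  in \<open>\<ell>\<^sup>2(X\<^sup>n)\<close>. Hence the completion consists of the Cauchy sequences of this form (where terms
  are compared by means of the connecting isometries), modulo those converging to zero. The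
  norm of a class is the limit of the norms of the terms.\<close>

type_synonym 'a tensor_seq = "nat \<Rightarrow> (nat \<Rightarrow> 'a) \<Rightarrow> complex"

definition itp_cauchy :: "'a set \<Rightarrow> (nat \<Rightarrow> 'a \<Rightarrow> complex) \<Rightarrow> 'a tensor_seq set" where
  "itp_cauchy X \<phi> = {\<Psi>. (\<forall>n. \<Psi> n \<in> ell2 (cube X n)) \<and>
     (\<forall>\<epsilon>>0. \<exists>N. \<forall>n\<ge>N. \<forall>k.
        ell2_norm (cube X (n + k)) (\<lambda>y. embed X \<phi> n k (\<Psi> n) y - \<Psi> (n + k) y) < \<epsilon>)}"

definition itp_rel :: "'a set \<Rightarrow> (nat \<Rightarrow> 'a \<Rightarrow> complex) \<Rightarrow> ('a tensor_seq \<times> 'a tensor_seq) set" where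
  "itp_rel X \<phi> = {(\<Psi>, \<Xi>). \<Psi> \<in> itp_cauchy X \<phi> \<and> \<Xi> \<in> itp_cauchy X \<phi> \<and>
     (\<lambda>n. ell2_norm (cube X n) (\<lambda>y. \<Psi> n y - \<Xi> n y)) \<longlonglongrightarrow> 0}"

definition itp_space :: "'a set \<Rightarrow> (nat \<Rightarrow> 'a \<Rightarrow> complex) \<Rightarrow> 'a tensor_seq set set" where
  "itp_space X \<phi> = itp_cauchy X \<phi> // itp_rel X \<phi>"

definition itp_class :: "'a set \<Rightarrow> (nat \<Rightarrow> 'a \<Rightarrow> complex) \<Rightarrow> 'a tensor_seq \<Rightarrow> 'a tensor_seq set" where
  "itp_class X \<phi> \<Psi> = itp_rel X \<phi> `` {\<Psi>}"

definition itp_rep :: "'a tensor_seq set \<Rightarrow> 'a tensor_seq" where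
  "itp_rep \<xi> = (SOME \<Psi>. \<Psi> \<in> \<xi>)"

definition itp_plus ::
    "'a set \<Rightarrow> (nat \<Rightarrow> 'a \<Rightarrow> complex) \<Rightarrow> 'a tensor_seq set \<Rightarrow> 'a tensor_seq set \<Rightarrow> 'a tensor_seq set" where
  "itp_plus X \<phi> \<xi> \<eta> = itp_class X \<phi> (\<lambda>n y. itp_rep \<xi> n y + itp_rep \<eta> n y)"

definition itp_scale ::
    "'a set \<Rightarrow> (nat \<Rightarrow> 'a \<Rightarrow> complex) \<Rightarrow> complex \<Rightarrow> 'a tensor_seq set \<Rightarrow> 'a tensor_seq set" where
  "itp_scale X \<phi> c \<xi> = itp_class X \<phi> (\<lambda>n y. c * itp_rep \<xi> n y)"

definition itp_norm :: "'a set \<Rightarrow> 'a tensor_seq set \<Rightarrow> real" where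
  "itp_norm X \<xi> = lim (\<lambda>n. ell2_norm (cube X n) (itp_rep \<xi> n))"

definition itp_bounded_op ::
    "'a set \<Rightarrow> (nat \<Rightarrow> 'a \<Rightarrow> complex) \<Rightarrow> ('a tensor_seq set \<Rightarrow> 'a tensor_seq set) \<Rightarrow> bool" where
  "itp_bounded_op X \<phi> S \<longleftrightarrow>
     (\<forall>\<xi>\<in>itp_space X \<phi>. S \<xi> \<in> itp_space X \<phi>) \<and>
     (\<forall>\<xi>\<in>itp_space X \<phi>. \<forall>\<eta>\<in>itp_space X \<phi>. S (itp_plus X \<phi> \<xi> \<eta>) = itp_plus X \<phi> (S \<xi>) (S \<eta>)) \<and>
     (\<forall>c. \<forall>\<xi>\<in>itp_space X \<phi>. S (itp_scale X \<phi> c \<xi>) = itp_scale X \<phi> c (S \<xi>)) \<and>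
     (\<exists>C. \<forall>\<xi>\<in>itp_space X \<phi>. itp_norm X (S \<xi>) \<le> C * itp_norm X \<xi>)"

text \<open>The operator on \<open>\<ell>\<^sup>2(X\<^sup>n)\<close> acting as \<open>T\<close> in the factor \<open>i < n\<close> and as the identity in the
  others: \<open>T\<close> is applied to the functions obtained by freezing all coordinates except the \<open>i\<close>-th.\<close>

definition factor_op ::
    "'a set \<Rightarrow> nat \<Rightarrow> nat \<Rightarrow> (('a \<Rightarrow> complex) \<Rightarrow> 'a \<Rightarrow> complex) \<Rightarrow>
     ((nat \<Rightarrow> 'a) \<Rightarrow> complex) \<Rightarrow> (nat \<Rightarrow> 'a) \<Rightarrow> complex" where
  "factor_op X n i T \<psi> = (\<lambda>y. if y \<in> cube X n then T (\<lambda>a. \<psi> (y(i := a))) (y i) else 0)"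

definition tensor_op ::
    "'a set \<Rightarrow> nat \<Rightarrow> (nat \<Rightarrow> ('a \<Rightarrow> complex) \<Rightarrow> 'a \<Rightarrow> complex) \<Rightarrow>
     ((nat \<Rightarrow> 'a) \<Rightarrow> complex) \<Rightarrow> (nat \<Rightarrow> 'a) \<Rightarrow> complex" where
  "tensor_op X n T \<psi> = fold (\<lambda>i. factor_op X n i (T i)) [0..<n] \<psi>"

text \<open>For finite \<open>J\<close>, the operator on the infinite tensor product acting as \<open>T i\<close> in the factors
  \<open>i \<in> J\<close> and as the identity in the others. The finitely many terms with \<open>n \<le> Max J\<close>, in
  which some factors of \<open>J\<close> are missing, do not affect the class.\<close>

definition itp_op ::
    "'a set \<Rightarrow> (nat \<Rightarrow> 'a \<Rightarrow> complex) \<Rightarrow> (nat \<Rightarrow> ('a \<Rightarrow> complex) \<Rightarrow> 'a \<Rightarrow> complex) \<Rightarrow> nat set \<Rightarrow>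
     'a tensor_seq set \<Rightarrow> 'a tensor_seq set" where
  "itp_op X \<phi> T J \<xi> =
     itp_class X \<phi> (\<lambda>n. tensor_op X n (\<lambda>i. if i \<in> J then T i else (\<lambda>f. f)) (itp_rep \<xi> n))"

definition itp_op_exists ::
    "'a set \<Rightarrow> (nat \<Rightarrow> 'a \<Rightarrow> complex) \<Rightarrow> (nat \<Rightarrow> ('a \<Rightarrow> complex) \<Rightarrow> 'a \<Rightarrow> complex) \<Rightarrow> bool" where
  "itp_op_exists X \<phi> T \<longleftrightarrow> (\<exists>S. itp_bounded_op X \<phi> S \<and>
     (\<forall>\<xi>\<in>itp_space X \<phi>.
        ((\<lambda>J. itp_norm X (itp_plus X \<phi> (itp_op X \<phi> T J \<xi>) (itp_scale X \<phi> (-1) (S \<xi>)))) \<longlongrightarrow> 0)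
          (finite_subsets_at_top UNIV)))"

end

theory Submission
  imports Defs "HOL-Library.Poly_Mapping"
begin

text \<open>By amenability there are finitely supported unit vectors \<open>\<phi>\<^sub>i\<close> that are moved by less
  than \<open>2\<^sup>-\<^sup>i\<close> by the translations by the first \<open>i\<close> elements of the group. Convergence of the
  product forces \<open>v\<^sub>j \<rightarrow> 1\<close> pointwise, so a subsequence \<open>(u\<^sub>i)\<close> can be chosen so close to \<open>1\<close> near
  the support of \<open>\<phi>\<^sub>i\<close> that \<open>\<Sum>\<^sub>i \<parallel>\<lambda>\<^bsub>u\<^sub>i\<^esub>(x) \<phi>\<^sub>i - \<phi>\<^sub>i\<parallel>\<close> converges for every \<open>x\<close>. This makes the partial
  tensor products of the isometries \<open>\<lambda>\<^bsub>u\<^sub>i\<^esub>(x)\<close> a strongly Cauchy net.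

  Almost invariant vectors come from an invariant mean as usual: otherwise the differences
  \<open>x p - p\<close>, for finitely supported probability distributions \<open>p\<close>, are bounded away from \<open>0\<close> in
  \<open>\<ell>\<^sup>1\<close>, and a separating functional is a bounded function contradicting the invariance of the
  mean. Finally \<open>\<phi> = \<surd>p\<close>.\<close>

section \<open>Sublinear functionals and separation\<close>

text \<open>Homogeneity is demanded only as an inequality for positive \<open>c\<close>; applying it
  to \<open>inverse c\<close> gives equality, so infima of families need checking in one direction
  only.\<close>

definition sublinear :: "('v::real_vector \<Rightarrow> real) \<Rightarrow> bool" where
  "sublinear q \<longleftrightarrow> (\<forall>x y. q (x + y) \<le> q x + q y) \<and> (\<forall>c>0. \<forall>x. q (c *\<^sub>R x) \<le> c * q x)"

lemma sublinearD:
  assumes "sublinear q"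
  shows "q (x + y) \<le> q x + q y" "c > 0 \<Longrightarrow> q (c *\<^sub>R x) = c * q x" "q 0 = 0" "- q (- x) \<le> q x"
proof -
  show add: "q (x + y) \<le> q x + q y" for x y
    using assms by (simp add: sublinear_def)
  have le: "q (c *\<^sub>R x) \<le> c * q x" if "c > 0" for c x
    using assms that by (simp add: sublinear_def)
  show "q (c *\<^sub>R x) = c * q x" if "c > 0"
  proof (rule antisym[OF le[OF that]])
    have "q x \<le> inverse c * q (c *\<^sub>R x)"
      using le[of "inverse c" "c *\<^sub>R x"] that by simp
    then show "c * q x \<le> q (c *\<^sub>R x)"
      using that by (simp add: field_simps)
  qed
  show 0: "q 0 = 0"
    using le[of "1/2" 0] add[of 0 0] by simp
  show "- q (- x) \<le> q x"
    using add[of x "- x"] 0 by simp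
qed

text \<open>Of two members of the chain one lies below the other, and its subadditivity gives
  \<open>?u (x + y) \<le> s x + s' y\<close>. The infima over \<open>s'\<close> and over
  \<open>s\<close> are then taken one after the other.\<close>

lemma sublinear_chain_Inf:
  assumes C: "C \<noteq> {}" "\<And>s. s \<in> C \<Longrightarrow> sublinear s"
    and chain: "\<And>s s'. s \<in> C \<Longrightarrow> s' \<in> C \<Longrightarrow> s \<le> s' \<or> s' \<le> s"
    and bdd: "\<And>x. bdd_below ((\<lambda>s. s x) ` C)"
  shows "sublinear (\<lambda>x. INF s\<in>C. s x)" (is "sublinear ?u")
  unfolding sublinear_def
proof (intro conjI allI impI)
  have low: "?u x \<le> s x" if "s \<in> C" for s x
    using that by (intro cINF_lower bdd)
  fix x y
  have "?u (x + y) \<le> s x + s' y" if s: "s \<in> C" "s' \<in> C" for s s'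
  proof (cases "s \<le> s'")
    case True
    have "?u (x + y) \<le> s (x + y)" by (rule low[OF s(1)])
    also have "\<dots> \<le> s x + s y" using sublinearD(1)[OF C(2)[OF s(1)]] .
    also have "\<dots> \<le> s x + s' y" using True by (simp add: le_fun_def)
    finally show ?thesis .
  next
    case False
    then have "s' \<le> s" using chain s by blast
    have "?u (x + y) \<le> s' (x + y)" by (rule low[OF s(2)])
    also have "\<dots> \<le> s' x + s' y" using sublinearD(1)[OF C(2)[OF s(2)]] .
    also have "\<dots> \<le> s x + s' y" using \<open>s' \<le> s\<close> by (simp add: le_fun_def)
    finally show ?thesis .
  qed
  note two = this
  have "?u (x + y) - s x \<le> ?u y" if s: "s \<in> C" for s
  proof (rule cINF_greatest[OF C(1)])
    show "?u (x + y) - s x \<le> s' y" if "s' \<in> C" for s'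
      using two[OF s that] by simp
  qed
  note one = this
  have "?u (x + y) - ?u y \<le> ?u x"
  proof (rule cINF_greatest[OF C(1)])
    show "?u (x + y) - ?u y \<le> s x" if "s \<in> C" for s
      using one[OF that] by simp
  qed
  then show "?u (x + y) \<le> ?u x + ?u y" by simp
next
  fix c :: real and x
  assume c: "c > 0"
  have "?u (c *\<^sub>R x) / c \<le> s x" if "s \<in> C" for s
    using cINF_lower[OF bdd[of "c *\<^sub>R x"] that] sublinearD(2)[OF C(2)[OF that] c, of x] c
    by (simp add: field_simps)
  then have "?u (c *\<^sub>R x) / c \<le> ?u x"
    using C(1) by (intro cINF_greatest) auto
  then show "?u (c *\<^sub>R x) \<le> c * ?u x"
    using c by (simp add: field_simps)
qed

text \<open>Minimality is tested against \<open>x \<mapsto> inf\<^bsub>t \<ge> 0\<^esub> (m (x + t y) - t m y)\<close>.\<close>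

lemma minimal_sublinear_linear:
  assumes m: "sublinear m" and min: "\<And>s. sublinear s \<Longrightarrow> s \<le> m \<Longrightarrow> s = m"
  shows "linear m"
proof -
  note mD = sublinearD[OF m]
  have ge: "m (x + y) \<ge> m x + m y" for x y
  proof -
    define s where "s x = (INF t\<in>{0..}. m (x + t *\<^sub>R y) - t * m y)" for x
    have ty: "m (t *\<^sub>R y) = t * m y" if "t \<ge> 0" for t
      using mD(2)[of t y] mD(3) that by (cases "t = 0") auto
    have bdd: "bdd_below ((\<lambda>t. m (x + t *\<^sub>R y) - t * m y) ` {0..})" for x
    proof (rule bdd_belowI2[where m = "- m (- x)"])
      fix t :: real
      assume "t \<in> {0..}"
      then show "- m (- x) \<le> m (x + t *\<^sub>R y) - t * m y"
        using mD(1)[of "x + t *\<^sub>R y" "- x"] ty[of t] by simp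
    qed
    have low: "s x \<le> m (x + t *\<^sub>R y) - t * m y" if "t \<ge> 0" for x t
      unfolding s_def using that by (intro cINF_lower bdd) auto
    have "sublinear s"
      unfolding sublinear_def
    proof (intro conjI allI impI)
      fix x x'
      have two: "s (x + x') \<le> (m (x + t *\<^sub>R y) - t * m y) + (m (x' + t' *\<^sub>R y) - t' * m y)"
        if "t \<ge> 0" "t' \<ge> 0" for t t'
        using low[of "t + t'" "x + x'"] mD(1)[of "x + t *\<^sub>R y" "x' + t' *\<^sub>R y"] that
        by (simp add: algebra_simps)
      have one: "s (x + x') - (m (x + t *\<^sub>R y) - t * m y) \<le> s x'" if t: "t \<ge> 0" for t
        unfolding s_def[of x']
      proof (rule cINF_greatest)
        show "s (x + x') - (m (x + t *\<^sub>R y) - t * m y) \<le> m (x' + t' *\<^sub>R y) - t' * m y"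
          if "t' \<in> {0..}" for t'
          using two[OF t, of t'] that by simp
      qed simp
      have "s (x + x') - s x' \<le> s x"
        unfolding s_def[of x]
      proof (rule cINF_greatest)
        show "s (x + x') - s x' \<le> m (x + t *\<^sub>R y) - t * m y" if "t \<in> {0..}" for t
          using one[of t] that by simp
      qed simp
      then show "s (x + x') \<le> s x + s x'" by simp
    next
      fix c :: real and x
      assume c: "c > 0"
      have "s (c *\<^sub>R x) / c \<le> m (x + t *\<^sub>R y) - t * m y" if "t \<ge> 0" for t
        using low[of "c * t" "c *\<^sub>R x"] mD(2)[OF c, of "x + t *\<^sub>R y"] c that
        by (simp add: field_simps)
      then have "s (c *\<^sub>R x) / c \<le> s x"
        unfolding s_def[of x] by (intro cINF_greatest) auto
      then show "s (c *\<^sub>R x) \<le> c * s x"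
        using c by (simp add: field_simps)
    qed
    moreover have "s \<le> m"
      using low[of 0] by (simp add: le_fun_def)
    ultimately have "s = m" by (rule min)
    \<comment> \<open>With \<open>s = m\<close>, the parameter \<open>t = 1\<close> in the infimum
      reads \<open>m x \<le> m (x + y) - m y\<close>, which is superadditivity.\<close>
    then show ?thesis
      using low[of 1 x] by simp
  qed
  then have add: "m (x + y) = m x + m y" for x y
    using mD(1)[of x y] by (simp add: antisym)
  have neg: "m (- x) = - m x" for x
    using add[of x "- x"] mD(3) by simp
  show ?thesis
  proof (rule linearI[OF add])
    fix c :: real and x
    consider "c > 0" | "c = 0" | "c < 0" by linarith
    then show "m (c *\<^sub>R x) = c *\<^sub>R m x"
    proof cases
      case 3
      then show ?thesis using mD(2)[of "- c" x] neg[of "c *\<^sub>R x"] by simp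
    qed (auto simp: mD)
  qed
qed

text \<open>Hahn-Banach in its sublinear form: by Zorn there is a minimal sublinear functional below
  \<open>q\<close>, and minimality forces linearity.\<close>

lemma linear_below_sublinear:
  fixes q :: "'v::real_vector \<Rightarrow> real"
  assumes q: "sublinear q"
  obtains l where "linear l" "\<And>x. l x \<le> q x"
proof -
  define A where "A = {s. sublinear s \<and> s \<le> q}"
  have "\<exists>m\<in>A. \<forall>a\<in>A. m \<ge> a \<longrightarrow> a = m"
  \<comment> \<open>The order is reversed, so that the maximal element supplied by Zorn is a minimal
    functional and chains need lower bounds.\<close>
  proof (rule predicate_Zorn)
    show "partial_order_on A (relation_of (\<lambda>s s'. s \<ge> s') A)"
      by (auto intro!: partial_order_on_relation_ofI)
    fix C
    assume C: "C \<in> Chains (relation_of (\<lambda>s s'. s \<ge> s') A)"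
    show "\<exists>u\<in>A. \<forall>a\<in>C. u \<le> a"
    proof (cases "C = {}")
      case True
      then show ?thesis using q by (auto simp: A_def)
    next
      case False
      have CA: "s \<in> A" if "s \<in> C" for s
        using C that by (auto simp: Chains_def relation_of_def)
      \<comment> \<open>Since \<open>- s (- x) \<le> s x\<close> and \<open>s \<le> q\<close>, there
        is a lower bound independent of \<open>s\<close>, so the pointwise infimum of the chain is
        finite.\<close>
      have bdd: "bdd_below ((\<lambda>s. s x) ` C)" for x
      proof (rule bdd_belowI2[where m = "- q (- x)"])
        fix s
        assume "s \<in> C"
        then have "sublinear s" "s (- x) \<le> q (- x)"
          using CA by (auto simp: A_def le_fun_def)
        then show "- q (- x) \<le> s x"
          using sublinearD(4)[of s x] by simp
      qed
      define u where "u x = (INF s\<in>C. s x)" for x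
      have low: "u \<le> s" if "s \<in> C" for s
        unfolding u_def le_fun_def using that by (auto intro!: cINF_lower bdd)
      have "sublinear u"
        unfolding u_def
      proof (rule sublinear_chain_Inf[OF False _ _ bdd])
        show "sublinear s" if "s \<in> C" for s
          using CA[OF that] by (simp add: A_def)
        show "s \<le> s' \<or> s' \<le> s" if "s \<in> C" "s' \<in> C" for s s'
          using C that unfolding Chains_def relation_of_def by blast
      qed
      moreover have "u \<le> q"
        using False low CA by (force simp: A_def intro: order_trans)
      ultimately show ?thesis
        using low by (auto simp: A_def)
    qed
  qed
  then obtain m where m: "sublinear m" "m \<le> q"
    and min: "\<And>s. sublinear s \<Longrightarrow> s \<le> q \<Longrightarrow> s \<le> m \<Longrightarrow> s = m"
    by (auto simp: A_def)
  have "linear m"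
    using m min by (intro minimal_sublinear_linear) (auto intro: order_trans)
  with m(2) show ?thesis
    by (intro that) (auto simp: le_fun_def)
qed

text \<open>Hahn-Banach separation of \<open>K\<close> from the open \<open>n\<close>-ball of radius
  \<open>\<epsilon>\<close>: any linear functional below the \<open>q\<close> constructed here does
  both jobs, as \<open>t = 0\<close> and \<open>t = 1\<close> in the infimum show.\<close>

lemma separate_convex_from_seminorm_ball:
  fixes n :: "'v::real_vector \<Rightarrow> real"
  assumes add: "\<And>x y. n (x + y) \<le> n x + n y"
    and scale: "\<And>c x. n (c *\<^sub>R x) = \<bar>c\<bar> * n x"
    and K: "convex K" "K \<noteq> {}" and ge: "\<And>k. k \<in> K \<Longrightarrow> \<epsilon> \<le> n k"
  obtains l where "linear l" "\<And>x. l x \<le> n x" "\<And>k. k \<in> K \<Longrightarrow> \<epsilon> \<le> l k"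
proof -
  have minus: "n (- x) = n x" for x
    using scale[of "-1" x] by simp
  define I where "I = {0::real..} \<times> K"
  have I: "I \<noteq> {}" using K(2) by (auto simp: I_def)
  define a where "a x = (\<lambda>(t, k). n (x + t *\<^sub>R k) - t * \<epsilon>)" for x
  \<comment> \<open>\<open>q\<close> is the largest sublinear functional below \<open>n\<close> with \<open>q (- k) \<le> - \<epsilon>\<close> for \<open>k \<in> K\<close>.\<close>
  define q where "q x = (INF i\<in>I. a x i)" for x
  have bdd: "bdd_below (a x ` I)" for x
  proof (rule bdd_belowI2[where m = "- n x"])
    fix i assume "i \<in> I"
    then obtain t k where i: "i = (t, k)" "t \<ge> 0" "k \<in> K" by (auto simp: I_def)
    \<comment> \<open>This is where \<open>\<epsilon> \<le> n k\<close> on \<open>K\<close> enters;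
      the resulting lower bound is uniform in \<open>t\<close> and \<open>k\<close> and keeps
      \<open>q\<close> finite.\<close>
    have "t * \<epsilon> \<le> n (t *\<^sub>R k)"
      using ge[OF i(3)] i(2) by (simp add: scale mult_left_mono)
    also have "\<dots> \<le> n (x + t *\<^sub>R k) + n x"
      using add[of "x + t *\<^sub>R k" "- x"] by (simp add: minus)
    finally show "- n x \<le> a x i"
      by (simp add: a_def i)
  qed
  have low: "q x \<le> n (x + t *\<^sub>R k) - t * \<epsilon>" if "t \<ge> 0" "k \<in> K" for x t k
    using cINF_lower[OF bdd, of "(t, k)" x] that by (simp add: q_def a_def I_def)
  have great: "b \<le> q x" if "\<And>t k. t \<ge> 0 \<Longrightarrow> k \<in> K \<Longrightarrow> b \<le> n (x + t *\<^sub>R k) - t * \<epsilon>" for b x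
    unfolding q_def using I by (intro cINF_greatest) (auto simp: a_def I_def that)
  have "sublinear q"
    unfolding sublinear_def
  proof (intro conjI allI impI)
    fix x y
    have two: "q (x + y) \<le> (n (x + t *\<^sub>R k) - t * \<epsilon>) + (n (y + t' *\<^sub>R k') - t' * \<epsilon>)"
      if tk: "t \<ge> 0" "k \<in> K" "t' \<ge> 0" "k' \<in> K" for t k t' k'
    proof -
      \<comment> \<open>Convexity turns a sum of two points of the cone over \<open>K\<close> into a
        multiple of a single point of \<open>K\<close>. The weights are normalised by
        \<open>t + t'\<close>, whence the separate case of sum \<open>0\<close>.\<close>
      obtain k'' where k'': "k'' \<in> K" "(t + t') *\<^sub>R k'' = t *\<^sub>R k + t' *\<^sub>R k'"
      proof (cases "t + t' = 0")
        case True
        then have "t = 0" "t' = 0" using tk by auto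
        then show ?thesis using that[of k] tk by simp
      next
        case False
        then have pos: "t + t' > 0" using tk by simp
        have "(t / (t + t')) *\<^sub>R k + (t' / (t + t')) *\<^sub>R k' \<in> K"
          using pos tk by (intro convexD[OF K(1)]) (simp_all flip: add_divide_distrib)
        moreover have "(t + t') * (t / (t + t')) = t" "(t + t') * (t' / (t + t')) = t'"
          using pos by simp_all
        ultimately show ?thesis
          using pos by (intro that) (auto simp only: scaleR_add_right scaleR_scaleR)
      qed
      have eq: "x + y + (t + t') *\<^sub>R k'' = (x + t *\<^sub>R k) + (y + t' *\<^sub>R k')"
        using k''(2) by (simp add: algebra_simps)
      show ?thesis
        using low[of "t + t'" k'' "x + y"] tk k'' add[of "x + t *\<^sub>R k" "y + t' *\<^sub>R k'"]
        unfolding eq by (simp add: algebra_simps)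
    qed
    have one: "q (x + y) - (n (x + t *\<^sub>R k) - t * \<epsilon>) \<le> q y" if tk: "t \<ge> 0" "k \<in> K" for t k
    proof (rule great)
      show "q (x + y) - (n (x + t *\<^sub>R k) - t * \<epsilon>) \<le> n (y + t' *\<^sub>R k') - t' * \<epsilon>"
        if "t' \<ge> 0" "k' \<in> K" for t' k'
        using two[OF tk that] by simp
    qed
    have "q (x + y) - q y \<le> q x"
    proof (rule great)
      show "q (x + y) - q y \<le> n (x + t *\<^sub>R k) - t * \<epsilon>" if "t \<ge> 0" "k \<in> K" for t k
        using one[OF that] by simp
    qed
    then show "q (x + y) \<le> q x + q y" by simp
  next
    fix c :: real and x
    assume c: "c > 0"
    have "q (c *\<^sub>R x) / c \<le> n (x + t *\<^sub>R k) - t * \<epsilon>" if "t \<ge> 0" "k \<in> K" for t k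
      using low[of "c * t" k "c *\<^sub>R x"] scale[of c "x + t *\<^sub>R k"] c that
      by (simp add: field_simps)
    then have "q (c *\<^sub>R x) / c \<le> q x"
      by (rule great)
    then show "q (c *\<^sub>R x) \<le> c * q x"
      using c by (simp add: field_simps)
  qed
  then obtain l where l: "linear l" "\<And>x. l x \<le> q x"
    by (rule linear_below_sublinear) blast
  obtain k0 where k0: "k0 \<in> K" using K(2) by blast
  show ?thesis
  proof (rule that[OF l(1)])
    show "l x \<le> n x" for x
      using l(2)[of x] low[of 0 k0 x] k0 by simp
    \<comment> \<open>Taking \<open>t = 1\<close> at the point \<open>- k\<close> makes the argument
      of \<open>n\<close> vanish, so \<open>l (- k) \<le> - \<epsilon>\<close>.\<close>
    show "\<epsilon> \<le> l k" if "k \<in> K" for k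
      using l(2)[of "- k"] low[of 1 k "- k"] that scale[of 0 0] linear_neg[OF l(1), of k] by simp
  qed
qed

section \<open>Finitely supported functions as a real vector space with the l1 norm\<close>

instantiation poly_mapping :: (type, real_vector) real_vector
begin

lift_definition scaleR_poly_mapping :: "real \<Rightarrow> ('a \<Rightarrow>\<^sub>0 'b) \<Rightarrow> 'a \<Rightarrow>\<^sub>0 'b"
  is "\<lambda>r f x. r *\<^sub>R f x"
  by (rule finite_subset) auto

instance
  by intro_classes (transfer, simp add: fun_eq_iff algebra_simps)+

end

lemma lookup_scaleR: "Poly_Mapping.lookup (c *\<^sub>R f) i = c *\<^sub>R Poly_Mapping.lookup f i"
  by transfer simp

definition l1_norm :: "('i \<Rightarrow>\<^sub>0 real) \<Rightarrow> real" where
  "l1_norm w = (\<Sum>i\<in>Poly_Mapping.keys w. \<bar>Poly_Mapping.lookup w i\<bar>)"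

lemma l1_norm_eq:
  assumes "finite B" "Poly_Mapping.keys w \<subseteq> B"
  shows "l1_norm w = (\<Sum>i\<in>B. \<bar>Poly_Mapping.lookup w i\<bar>)"
  unfolding l1_norm_def using assms by (intro sum.mono_neutral_left) (auto simp: in_keys_iff)

lemma sum_abs_le_l1_norm:
  assumes "finite B"
  shows "(\<Sum>i\<in>B. \<bar>Poly_Mapping.lookup w i\<bar>) \<le> l1_norm w"
  using assms by (subst l1_norm_eq[of "B \<union> Poly_Mapping.keys w"]) (auto intro: sum_mono2)

lemma l1_norm_add: "l1_norm (v + w) \<le> l1_norm v + l1_norm w"
proof -
  let ?B = "Poly_Mapping.keys v \<union> Poly_Mapping.keys w"
  have "l1_norm (v + w) = (\<Sum>i\<in>?B. \<bar>Poly_Mapping.lookup (v + w) i\<bar>)"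
    using Poly_Mapping.keys_add[of v w] by (intro l1_norm_eq) auto
  also have "\<dots> \<le> (\<Sum>i\<in>?B. \<bar>Poly_Mapping.lookup v i\<bar> + \<bar>Poly_Mapping.lookup w i\<bar>)"
    by (intro sum_mono) (simp add: lookup_add)
  also have "\<dots> = l1_norm v + l1_norm w"
    by (simp add: sum.distrib l1_norm_eq[of ?B])
  finally show ?thesis .
qed

lemma l1_norm_scaleR: "l1_norm (c *\<^sub>R w) = \<bar>c\<bar> * l1_norm w"
proof -
  have "l1_norm (c *\<^sub>R w) = (\<Sum>i\<in>Poly_Mapping.keys w. \<bar>Poly_Mapping.lookup (c *\<^sub>R w) i\<bar>)"
    by (intro l1_norm_eq) (auto simp: in_keys_iff lookup_scaleR)
  then show ?thesis
    by (simp add: lookup_scaleR abs_mult l1_norm_def sum_distrib_left)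
qed

section \<open>Square summable functions\<close>

lemma ell2_outside: "f \<in> ell2 A \<Longrightarrow> x \<notin> A \<Longrightarrow> f x = 0"
  by (simp add: ell2_def)

lemma ell2_norm_nonneg: "0 \<le> ell2_norm A f"
  by (simp add: ell2_norm_def infsum_nonneg)

lemma ell2_norm_cong: "(\<And>x. x \<in> A \<Longrightarrow> cmod (f x) = cmod (g x)) \<Longrightarrow> ell2_norm A f = ell2_norm A g"
  unfolding ell2_norm_def by (metis (mono_tags, lifting) infsum_cong)

lemma ell2_norm_zero [simp]: "ell2_norm A (\<lambda>x. 0) = 0"
  by (simp add: ell2_norm_def)

lemma L2_set_le_ell2_norm:
  assumes "f \<in> ell2 A" "finite B" "B \<subseteq> A"
  shows "L2_set (\<lambda>x. cmod (f x)) B \<le> ell2_norm A f"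
  using assms unfolding L2_set_def ell2_norm_def
  by (intro real_sqrt_le_mono finite_sum_le_infsum) (auto simp: ell2_def)

text \<open>Nonnegative terms with bounded finite partial sums are summable, so membership and norm
  bound both reduce to \<open>L2_set\<close> on finite sets. This carries finite estimates such as
  Minkowski's inequality to infinite index sets.\<close>

lemma ell2_bounded_L2_set:
  assumes "\<And>x. x \<notin> A \<Longrightarrow> f x = 0"
    and bound: "\<And>B. finite B \<Longrightarrow> B \<subseteq> A \<Longrightarrow> L2_set (\<lambda>x. cmod (f x)) B \<le> C"
  shows "f \<in> ell2 A" "ell2_norm A f \<le> C"
proof -
  have C: "0 \<le> C" using bound[of "{}"] by simp
  have le: "(\<Sum>x\<in>B. (cmod (f x))\<^sup>2) \<le> C\<^sup>2" if "finite B" "B \<subseteq> A" for B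
    using bound[OF that] C unfolding L2_set_def by (simp add: real_le_rsqrt sqrt_le_D)
  have s: "(\<lambda>x. (cmod (f x))\<^sup>2) summable_on A"
    using le by (intro nonneg_bdd_above_summable_on bdd_aboveI2[where M = "C\<^sup>2"]) auto
  with assms(1) show "f \<in> ell2 A" by (simp add: ell2_def)
  have "(\<Sum>\<^sub>\<infinity>x\<in>A. (cmod (f x))\<^sup>2) \<le> C\<^sup>2"
    using le by (intro infsum_le_finite_sums s)
  then show "ell2_norm A f \<le> C"
    using C unfolding ell2_norm_def by (simp add: real_le_lsqrt)
qed

lemma ell2_add_triangle:
  assumes "f \<in> ell2 A" "g \<in> ell2 A"
  shows "(\<lambda>x. f x + g x) \<in> ell2 A \<and> ell2_norm A (\<lambda>x. f x + g x) \<le> ell2_norm A f + ell2_norm A g"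
proof -
  have "L2_set (\<lambda>x. cmod (f x + g x)) B \<le> ell2_norm A f + ell2_norm A g"
    if "finite B" "B \<subseteq> A" for B
  proof -
    have "L2_set (\<lambda>x. cmod (f x + g x)) B \<le> L2_set (\<lambda>x. cmod (f x) + cmod (g x)) B"
      by (intro L2_set_mono norm_triangle_ineq) auto
    also have "\<dots> \<le> L2_set (\<lambda>x. cmod (f x)) B + L2_set (\<lambda>x. cmod (g x)) B"
      by (rule L2_set_triangle_ineq)
    also have "\<dots> \<le> ell2_norm A f + ell2_norm A g"
      using assms that by (intro add_mono L2_set_le_ell2_norm)
    finally show ?thesis .
  qed
  with ell2_bounded_L2_set[of A "\<lambda>x. f x + g x" "ell2_norm A f + ell2_norm A g"] assms
  show ?thesis by (simp add: ell2_outside)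
qed

lemmas ell2_add = ell2_add_triangle[THEN conjunct1]
  and ell2_norm_triangle = ell2_add_triangle[THEN conjunct2]

lemma ell2_scale:
  assumes "f \<in> ell2 A"
  shows "(\<lambda>x. c * f x) \<in> ell2 A"
  using assms by (auto simp: ell2_def norm_mult power_mult_distrib intro: summable_on_cmult_right)

lemma ell2_norm_scale: "ell2_norm A (\<lambda>x. c * f x) = cmod c * ell2_norm A f"
  by (simp add: ell2_norm_def norm_mult power_mult_distrib infsum_cmult_right' real_sqrt_mult)

lemma ell2_diff:
  assumes "f \<in> ell2 A" "g \<in> ell2 A"
  shows "(\<lambda>x. f x - g x) \<in> ell2 A"
  using ell2_add[OF assms(1) ell2_scale[OF assms(2), of "-1"]] by simp

lemma ell2_norm_minus_commute: "ell2_norm A (\<lambda>x. f x - g x) = ell2_norm A (\<lambda>x. g x - f x)"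
  by (intro ell2_norm_cong) (simp add: norm_minus_commute)

lemma ell2_norm_diff_triangle:
  assumes "f \<in> ell2 A" "g \<in> ell2 A" "h \<in> ell2 A"
  shows "ell2_norm A (\<lambda>x. f x - h x) \<le> ell2_norm A (\<lambda>x. f x - g x) + ell2_norm A (\<lambda>x. g x - h x)"
  using ell2_norm_triangle[OF ell2_diff[OF assms(1,2)] ell2_diff[OF assms(2,3)]] by simp

lemma abs_ell2_norm_diff:
  assumes "f \<in> ell2 A" "g \<in> ell2 A"
  shows "\<bar>ell2_norm A f - ell2_norm A g\<bar> \<le> ell2_norm A (\<lambda>x. f x - g x)"
  using ell2_norm_triangle[OF assms(1) ell2_diff[OF assms(2,1)]]
    ell2_norm_triangle[OF assms(2) ell2_diff[OF assms]] ell2_norm_minus_commute[of A f g]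
  by simp

text \<open>The bijection rearranges the unordered sum and the phases leave the moduli alone. The
  hypotheses determine \<open>g\<close> only on \<open>A\<close>, which is why membership is stated
  as equivalent to vanishing outside.\<close>

lemma ell2_monomial:
  assumes "f \<in> ell2 A" "bij_betw \<sigma> A A" "\<And>x. x \<in> A \<Longrightarrow> cmod (c x) = 1"
    and g: "\<And>x. x \<in> A \<Longrightarrow> g x = c x * f (\<sigma> x)"
  shows "g \<in> ell2 A \<longleftrightarrow> (\<forall>x. x \<notin> A \<longrightarrow> g x = 0)" "ell2_norm A g = ell2_norm A f"
proof -
  have eq: "(cmod (g x))\<^sup>2 = (cmod (f (\<sigma> x)))\<^sup>2" if "x \<in> A" for x
    using that assms(3) g by (simp add: norm_mult)
  show "ell2_norm A g = ell2_norm A f"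
    unfolding ell2_norm_def
    using infsum_reindex_bij_betw[OF assms(2), of "\<lambda>x. (cmod (f x))\<^sup>2"] eq
    by (simp cong: infsum_cong)
  have "(\<lambda>x. (cmod (g x))\<^sup>2) summable_on A"
    using summable_on_reindex_bij_betw[OF assms(2), of "\<lambda>x. (cmod (f x))\<^sup>2"] eq assms(1)
    by (simp cong: summable_on_cong add: ell2_def)
  then show "g \<in> ell2 A \<longleftrightarrow> (\<forall>x. x \<notin> A \<longrightarrow> g x = 0)"
    by (simp add: ell2_def)
qed

section \<open>Finite tensor powers as square summable functions on cubes\<close>

lemma cube_iff: "y \<in> cube X n \<longleftrightarrow> (\<forall>i<n. y i \<in> X) \<and> (\<forall>i\<ge>n. y i = undefined)"
  by (auto simp: cube_def PiE_iff extensional_def not_less)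

lemma cube_upd:
  assumes "y \<in> cube X n" "a \<in> X"
  shows "y(n := a) \<in> cube X (Suc n)" "restrict (y(n := a)) {..<n} = y"
  using assms by (simp_all add: cube_iff less_Suc_eq fun_eq_iff)

lemma cube_restrict:
  assumes "y \<in> cube X (Suc n)"
  shows "restrict y {..<n} \<in> cube X n" "y n \<in> X" "(restrict y {..<n})(n := y n) = y"
  using assms by (simp_all add: cube_iff fun_eq_iff)

lemma bij_betw_cube_Suc: "bij_betw (\<lambda>(y, a). y(n := a)) (cube X n \<times> X) (cube X (Suc n))"
proof (rule bij_betw_byWitness[where f' = "\<lambda>y. (restrict y {..<n}, y n)"])
  show "\<forall>p\<in>cube X n \<times> X.
      (restrict (case p of (y, a) \<Rightarrow> y(n := a)) {..<n}, (case p of (y, a) \<Rightarrow> y(n := a)) n) = p"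
    using cube_upd(2)[of _ X n] by (simp add: split_beta)
  show "\<forall>y\<in>cube X (Suc n). (case (restrict y {..<n}, y n) of (y, a) \<Rightarrow> y(n := a)) = y"
    using cube_restrict(3)[of _ X n] by simp
  show "(\<lambda>(y, a). y(n := a)) ` (cube X n \<times> X) \<subseteq> cube X (Suc n)"
    using cube_upd(1)[of _ X n] by (simp add: image_subset_iff)
  show "(\<lambda>y. (restrict y {..<n}, y n)) ` cube X (Suc n) \<subseteq> cube X n \<times> X"
    using cube_restrict(1,2)[of _ X n] by (simp add: image_subset_iff)
qed

text \<open>Over \<open>cube X n \<times> X\<close> the squared moduli factor, so by Fubini the sum
  is the product of two sums. For a unit vector \<open>f\<close> this is the isometry property of
  the connecting maps.\<close>

lemma tensor_vec_ell2:
  assumes "\<psi> \<in> ell2 (cube X n)" "f \<in> ell2 X"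
  shows "tensor_vec X n \<psi> f \<in> ell2 (cube X (Suc n))"
    and "ell2_norm (cube X (Suc n)) (tensor_vec X n \<psi> f) = ell2_norm (cube X n) \<psi> * ell2_norm X f"
proof -
  let ?g = "\<lambda>(y, a). (cmod (\<psi> y))\<^sup>2 * (cmod (f a))\<^sup>2"
  have s: "(\<lambda>y. (cmod (\<psi> y))\<^sup>2) summable_on cube X n" "(\<lambda>a. (cmod (f a))\<^sup>2) summable_on X"
    using assms by (auto simp: ell2_def)
  have eq: "(cmod (tensor_vec X n \<psi> f (case p of (y, a) \<Rightarrow> y(n := a))))\<^sup>2 = ?g p"
    if "p \<in> cube X n \<times> X" for p
  proof -
    obtain y a where p: "p = (y, a)" "y \<in> cube X n" "a \<in> X" using \<open>p \<in> _\<close> by auto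
    show ?thesis
      using cube_upd[OF p(2,3)] by (simp add: p(1) tensor_vec_def norm_mult power_mult_distrib)
  qed
  have inner: "((\<lambda>a. ?g (y, a)) has_sum (cmod (\<psi> y))\<^sup>2 * (\<Sum>\<^sub>\<infinity>a\<in>X. (cmod (f a))\<^sup>2)) X" for y
    using has_sum_cmult_right[OF has_sum_infsum[OF s(2)]] by simp
  have outer: "((\<lambda>y. (cmod (\<psi> y))\<^sup>2 * (\<Sum>\<^sub>\<infinity>a\<in>X. (cmod (f a))\<^sup>2)) has_sum
      (\<Sum>\<^sub>\<infinity>y\<in>cube X n. (cmod (\<psi> y))\<^sup>2) * (\<Sum>\<^sub>\<infinity>a\<in>X. (cmod (f a))\<^sup>2)) (cube X n)"
    by (rule has_sum_cmult_left[OF has_sum_infsum[OF s(1)]])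
  have sum: "?g summable_on cube X n \<times> X"
    by (rule summable_on_SigmaI[OF inner has_sum_imp_summable[OF outer]]) auto
  have val: "infsum ?g (cube X n \<times> X) =
      (\<Sum>\<^sub>\<infinity>y\<in>cube X n. (cmod (\<psi> y))\<^sup>2) * (\<Sum>\<^sub>\<infinity>a\<in>X. (cmod (f a))\<^sup>2)"
    by (rule infsumI[OF has_sum_SigmaI[OF inner outer sum]])
  note b = bij_betw_cube_Suc[of n X]
  have "(\<lambda>y. (cmod (tensor_vec X n \<psi> f y))\<^sup>2) summable_on cube X (Suc n)"
    using summable_on_reindex_bij_betw[OF b, of "\<lambda>y. (cmod (tensor_vec X n \<psi> f y))\<^sup>2"] sum eq
    by (simp cong: summable_on_cong)
  then show "tensor_vec X n \<psi> f \<in> ell2 (cube X (Suc n))"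
    by (simp add: ell2_def tensor_vec_def)
  have "(\<Sum>\<^sub>\<infinity>y\<in>cube X (Suc n). (cmod (tensor_vec X n \<psi> f y))\<^sup>2) = infsum ?g (cube X n \<times> X)"
    using infsum_reindex_bij_betw[OF b, of "\<lambda>y. (cmod (tensor_vec X n \<psi> f y))\<^sup>2"] eq
    by (simp cong: infsum_cong)
  then show "ell2_norm (cube X (Suc n)) (tensor_vec X n \<psi> f) = ell2_norm (cube X n) \<psi> * ell2_norm X f"
    by (simp add: ell2_norm_def val real_sqrt_mult)
qed

section \<open>Monomial operators and their finite tensor products\<close>

text \<open>The regular representation only permutes the coordinates and multiplies by phases. Tensor
  products of such operators are of the same form, so they are isometric without any further
  argument on Hilbert space tensor products of operators.\<close>

definition monomial ::
    "'a set \<Rightarrow> (('a \<Rightarrow> complex) \<Rightarrow> 'a \<Rightarrow> complex) \<Rightarrow> ('a \<Rightarrow> complex) \<Rightarrow> ('a \<Rightarrow> 'a) \<Rightarrow> bool" where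
  "monomial X T c \<sigma> \<longleftrightarrow> bij_betw \<sigma> X X \<and> (\<forall>y\<in>X. cmod (c y) = 1) \<and>
     (\<forall>f. \<forall>y\<in>X. T f y = c y * f (\<sigma> y))"

lemma monomial_id: "monomial X (\<lambda>f. f) (\<lambda>y. 1) (\<lambda>y. y)"
  by (simp add: monomial_def bij_betw_def)

definition cube_map :: "nat \<Rightarrow> (nat \<Rightarrow> 'a \<Rightarrow> 'a) \<Rightarrow> (nat \<Rightarrow> 'a) \<Rightarrow> nat \<Rightarrow> 'a" where
  "cube_map n \<sigma> y = (\<lambda>i. if i < n then \<sigma> i (y i) else y i)"

lemma bij_betw_cube_map:
  assumes "\<And>i. bij_betw (\<sigma> i) X X"
  shows "bij_betw (cube_map n \<sigma>) (cube X n) (cube X n)"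
proof (rule bij_betw_byWitness[where f' = "cube_map n (\<lambda>i. inv_into X (\<sigma> i))"])
  have *: "inv_into X (\<sigma> i) (\<sigma> i a) = a" "\<sigma> i (inv_into X (\<sigma> i) a) = a"
    "\<sigma> i a \<in> X" "inv_into X (\<sigma> i) a \<in> X" if "a \<in> X" for i a
    using assms[of i] that bij_betw_inv_into_left[of "\<sigma> i" X X a] bij_betw_inv_into_right[of "\<sigma> i" X X a]
      bij_betw_apply[OF assms[of i] that] bij_betw_apply[OF bij_betw_inv_into[OF assms[of i]] that] by auto
  show "\<forall>y\<in>cube X n. cube_map n (\<lambda>i. inv_into X (\<sigma> i)) (cube_map n \<sigma> y) = y"
    "\<forall>y\<in>cube X n. cube_map n \<sigma> (cube_map n (\<lambda>i. inv_into X (\<sigma> i)) y) = y"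
    by (simp_all add: cube_map_def cube_iff fun_eq_iff *)
  show "cube_map n \<sigma> ` cube X n \<subseteq> cube X n"
    "cube_map n (\<lambda>i. inv_into X (\<sigma> i)) ` cube X n \<subseteq> cube X n"
    by (simp_all add: cube_map_def cube_iff image_subset_iff *)
qed

text \<open>Each factor changes only its own coordinate, so phases and coordinate maps accumulate.
  The last factor of the list is outermost and evaluates the earlier ones at a point with coordinate
  \<open>m\<close> moved; hence the induction is over all \<open>y\<close>.\<close>

lemma fold_factor_op:
  assumes T: "\<forall>i. monomial X (T i) (c i) (\<sigma> i)"
    and "m \<le> n" "y \<in> cube X n"
  shows "fold (\<lambda>i. factor_op X n i (T i)) [0..<m] \<psi> y = (\<Prod>i<m. c i (y i)) * \<psi> (cube_map m \<sigma> y)"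
  using assms(2,3)
proof (induction m arbitrary: y)
  case 0
  then show ?case by (simp add: cube_map_def)
next
  case (Suc m)
  have X: "y m \<in> X" using Suc.prems by (simp add: cube_iff)
  have \<sigma>X: "\<sigma> m (y m) \<in> X"
    using T[rule_format, of m] X unfolding monomial_def by (blast dest: bij_betw_apply)
  define z where "z = y(m := \<sigma> m (y m))"
  have z: "z \<in> cube X n"
    using Suc.prems \<sigma>X by (simp add: z_def cube_iff)
  have eq: "cube_map m \<sigma> z = cube_map (Suc m) \<sigma> y"
    by (auto simp: z_def cube_map_def fun_eq_iff less_Suc_eq)
  have prod: "(\<Prod>i<m. c i (z i)) = (\<Prod>i<m. c i (y i))"
    by (intro prod.cong) (auto simp: z_def)
  have "fold (\<lambda>i. factor_op X n i (T i)) [0..<Suc m] \<psi> y =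
      c m (y m) * fold (\<lambda>i. factor_op X n i (T i)) [0..<m] \<psi> z"
    using Suc.prems X T[rule_format, of m] by (simp add: factor_op_def monomial_def z_def)
  also have "\<dots> = (\<Prod>i<Suc m. c i (y i)) * \<psi> (cube_map (Suc m) \<sigma> y)"
    using Suc.IH[OF _ z] Suc.prems(1) by (simp add: eq prod mult_ac)
  finally show ?case .
qed

lemma tensor_op_eq:
  assumes "\<forall>i. monomial X (T i) (c i) (\<sigma> i)" "y \<in> cube X n"
  shows "tensor_op X n T \<psi> y = (\<Prod>i<n. c i (y i)) * \<psi> (cube_map n \<sigma> y)"
  unfolding tensor_op_def using fold_factor_op[OF assms(1) order_refl assms(2)] by simp

text \<open>For \<open>n = 0\<close> the fold is empty and leaves the value \<open>\<psi> y\<close>;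
  otherwise the outermost \<open>factor_op\<close> truncates to the cube.\<close>

lemma tensor_op_outside:
  assumes "y \<notin> cube X n" "\<psi> y = 0"
  shows "tensor_op X n T \<psi> y = 0"
  using assms by (cases n) (simp_all add: tensor_op_def factor_op_def)

lemma tensor_op_cong:
  assumes "\<And>i. i < n \<Longrightarrow> T i = T' i"
  shows "tensor_op X n T \<psi> = tensor_op X n T' \<psi>"
proof -
  have "fold (\<lambda>i. factor_op X n i (T i)) [0..<n] \<psi> = fold (\<lambda>i. factor_op X n i (T' i)) [0..<n] \<psi>"
    using assms by (intro fold_cong) auto
  then show ?thesis by (simp add: tensor_op_def)
qed

lemma tensor_op_ell2:
  assumes "\<forall>i. monomial X (T i) (c i) (\<sigma> i)" "\<psi> \<in> ell2 (cube X n)"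
  shows "tensor_op X n T \<psi> \<in> ell2 (cube X n)"
    and "ell2_norm (cube X n) (tensor_op X n T \<psi>) = ell2_norm (cube X n) \<psi>"
proof -
  have b: "bij_betw (cube_map n \<sigma>) (cube X n) (cube X n)"
    using assms(1) by (intro bij_betw_cube_map) (simp add: monomial_def)
  have c: "cmod (\<Prod>i<n. c i (y i)) = 1" if "y \<in> cube X n" for y
    unfolding prod_norm[symmetric]
    using that assms(1) by (intro prod.neutral) (auto simp: cube_iff monomial_def)
  note m = ell2_monomial[where c = "\<lambda>y. \<Prod>i<n. c i (y i)" and g = "tensor_op X n T \<psi>",
      OF assms(2) b c tensor_op_eq[OF assms(1)]]
  show "ell2_norm (cube X n) (tensor_op X n T \<psi>) = ell2_norm (cube X n) \<psi>"
    by (rule m(2))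
  show "tensor_op X n T \<psi> \<in> ell2 (cube X n)"
    using m(1) assms(2) by (simp add: ell2_outside tensor_op_outside)
qed

lemma tensor_op_add:
  assumes "\<forall>i. monomial X (T i) (c i) (\<sigma> i)" "\<psi> \<in> ell2 (cube X n)" "\<theta> \<in> ell2 (cube X n)"
  shows "tensor_op X n T (\<lambda>y. \<psi> y + \<theta> y) = (\<lambda>y. tensor_op X n T \<psi> y + tensor_op X n T \<theta> y)"
proof
  fix y
  show "tensor_op X n T (\<lambda>y. \<psi> y + \<theta> y) y = tensor_op X n T \<psi> y + tensor_op X n T \<theta> y"
    using assms(2,3) by (cases "y \<in> cube X n")
      (simp_all add: tensor_op_eq[OF assms(1)] tensor_op_outside ell2_outside distrib_left)
qed

lemma tensor_op_scale:
  assumes "\<forall>i. monomial X (T i) (c i) (\<sigma> i)" "\<psi> \<in> ell2 (cube X n)"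
  shows "tensor_op X n T (\<lambda>y. a * \<psi> y) = (\<lambda>y. a * tensor_op X n T \<psi> y)"
proof
  fix y
  show "tensor_op X n T (\<lambda>y. a * \<psi> y) y = a * tensor_op X n T \<psi> y"
    using assms(2) by (cases "y \<in> cube X n")
      (simp_all add: tensor_op_eq[OF assms(1)] tensor_op_outside ell2_outside)
qed

lemma tensor_op_diff:
  assumes "\<forall>i. monomial X (T i) (c i) (\<sigma> i)" "\<psi> \<in> ell2 (cube X n)" "\<theta> \<in> ell2 (cube X n)"
  shows "tensor_op X n T (\<lambda>y. \<psi> y - \<theta> y) = (\<lambda>y. tensor_op X n T \<psi> y - tensor_op X n T \<theta> y)"
  using tensor_op_add[OF assms(1,2) ell2_scale[OF assms(3), of "-1"]]
    tensor_op_scale[OF assms(1,3), of "-1"] by simp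

text \<open>Phase and coordinate map of the last coordinate separate from those of the first
  \<open>n\<close>. For \<open>f = \<phi> n\<close> this says that moving \<open>T\<close> past a
  connecting isometry amounts to replacing \<open>\<phi> n\<close> by
  \<open>T n (\<phi> n)\<close>.\<close>

lemma tensor_op_tensor_vec:
  assumes T: "\<forall>i. monomial X (T i) (c i) (\<sigma> i)"
  shows "tensor_op X (Suc n) T (tensor_vec X n \<psi> f) = tensor_vec X n (tensor_op X n T \<psi>) (T n f)"
proof
  fix y
  show "tensor_op X (Suc n) T (tensor_vec X n \<psi> f) y = tensor_vec X n (tensor_op X n T \<psi>) (T n f) y"
  proof (cases "y \<in> cube X (Suc n)")
    case True
    let ?y = "restrict y {..<n}"
    have b: "bij_betw (cube_map (Suc n) \<sigma>) (cube X (Suc n)) (cube X (Suc n))"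
      using T by (intro bij_betw_cube_map) (simp add: monomial_def)
    have y: "?y \<in> cube X n" "y n \<in> X"
      using cube_restrict[OF True] by auto
    have "restrict (cube_map (Suc n) \<sigma> y) {..<n} = cube_map n \<sigma> ?y"
      by (auto simp: cube_map_def fun_eq_iff)
    then have "tensor_vec X n \<psi> f (cube_map (Suc n) \<sigma> y) =
        \<psi> (cube_map n \<sigma> ?y) * f (\<sigma> n (y n))"
      using bij_betw_apply[OF b True] by (simp add: tensor_vec_def cube_map_def)
    moreover have "T n f (y n) = c n (y n) * f (\<sigma> n (y n))"
      using T[rule_format, of n] y(2) by (simp add: monomial_def)
    moreover have "(\<Prod>i<n. c i (?y i)) = (\<Prod>i<n. c i (y i))"
      by (intro prod.cong) auto
    ultimately show ?thesis
      using True by (simp add: tensor_op_eq[OF T] y(1) tensor_vec_def)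
  next
    case False
    then show ?thesis by (simp add: tensor_op_outside tensor_vec_def)
  qed
qed

section \<open>Infinite tensor products\<close>

lemma embed_add: "embed X \<phi> n k (\<lambda>y. \<psi> y + \<theta> y) = (\<lambda>y. embed X \<phi> n k \<psi> y + embed X \<phi> n k \<theta> y)"
  by (induction k) (auto simp: tensor_vec_def fun_eq_iff distrib_right)

lemma embed_scale: "embed X \<phi> n k (\<lambda>y. a * \<psi> y) = (\<lambda>y. a * embed X \<phi> n k \<psi> y)"
  by (induction k) (auto simp: tensor_vec_def fun_eq_iff)

locale itp =
  fixes X :: "'a set" and \<phi> :: "nat \<Rightarrow> 'a \<Rightarrow> complex"
  assumes phi: "\<And>i. \<phi> i \<in> ell2 X" and norm_phi: "\<And>i. ell2_norm X (\<phi> i) = 1"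
begin

abbreviation nrm :: "nat \<Rightarrow> ((nat \<Rightarrow> 'a) \<Rightarrow> complex) \<Rightarrow> real" where
  "nrm n \<equiv> ell2_norm (cube X n)"

lemma embed_ell2:
  assumes "\<psi> \<in> ell2 (cube X n)"
  shows "embed X \<phi> n k \<psi> \<in> ell2 (cube X (n + k)) \<and> nrm (n + k) (embed X \<phi> n k \<psi>) = nrm n \<psi>"
proof (induction k)
  case (Suc k)
  then show ?case
    using tensor_vec_ell2[of "embed X \<phi> n k \<psi>" X "n + k" "\<phi> (n + k)"] phi norm_phi by simp
qed (use assms in simp)

lemma cauchy_ell2: "\<Psi> \<in> itp_cauchy X \<phi> \<Longrightarrow> \<Psi> n \<in> ell2 (cube X n)"
  by (simp add: itp_cauchy_def)

lemma cauchyD: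
  assumes "\<Psi> \<in> itp_cauchy X \<phi>" "\<epsilon> > 0"
  obtains N where "\<And>n k. n \<ge> N \<Longrightarrow> nrm (n + k) (\<lambda>y. embed X \<phi> n k (\<Psi> n) y - \<Psi> (n + k) y) < \<epsilon>"
  using assms unfolding itp_cauchy_def by blast

lemma cauchy_add:
  assumes \<Psi>: "\<Psi> \<in> itp_cauchy X \<phi>" and \<Xi>: "\<Xi> \<in> itp_cauchy X \<phi>"
  shows "(\<lambda>n y. \<Psi> n y + \<Xi> n y) \<in> itp_cauchy X \<phi>"
  unfolding itp_cauchy_def
proof (safe)
  show "(\<lambda>y. \<Psi> n y + \<Xi> n y) \<in> ell2 (cube X n)" for n
    using assms by (intro ell2_add cauchy_ell2)
  fix \<epsilon> :: real
  assume "\<epsilon> > 0"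
  then have \<epsilon>: "\<epsilon> / 2 > 0" by simp
  obtain N where N: "\<And>n k. n \<ge> N \<Longrightarrow> nrm (n + k) (\<lambda>y. embed X \<phi> n k (\<Psi> n) y - \<Psi> (n + k) y) < \<epsilon> / 2"
    using cauchyD[OF \<Psi> \<epsilon>] by blast
  obtain M where M: "\<And>n k. n \<ge> M \<Longrightarrow> nrm (n + k) (\<lambda>y. embed X \<phi> n k (\<Xi> n) y - \<Xi> (n + k) y) < \<epsilon> / 2"
    using cauchyD[OF \<Xi> \<epsilon>] by blast
  show "\<exists>N. \<forall>n\<ge>N. \<forall>k. nrm (n + k)
      (\<lambda>y. embed X \<phi> n k (\<lambda>y. \<Psi> n y + \<Xi> n y) y - (\<Psi> (n + k) y + \<Xi> (n + k) y)) < \<epsilon>"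
  proof (intro exI allI impI)
    fix n k
    assume n: "max N M \<le> n"
    have "nrm (n + k) (\<lambda>y. embed X \<phi> n k (\<lambda>y. \<Psi> n y + \<Xi> n y) y - (\<Psi> (n + k) y + \<Xi> (n + k) y)) =
      nrm (n + k) (\<lambda>y. (embed X \<phi> n k (\<Psi> n) y - \<Psi> (n + k) y) + (embed X \<phi> n k (\<Xi> n) y - \<Xi> (n + k) y))"
      by (simp add: embed_add algebra_simps)
    also have "\<dots> \<le> nrm (n + k) (\<lambda>y. embed X \<phi> n k (\<Psi> n) y - \<Psi> (n + k) y) +
      nrm (n + k) (\<lambda>y. embed X \<phi> n k (\<Xi> n) y - \<Xi> (n + k) y)"
      using assms by (intro ell2_norm_triangle ell2_diff) (auto simp: embed_ell2 cauchy_ell2)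
    also have "\<dots> < \<epsilon>" using N[of n k] M[of n k] n by simp
    finally show "nrm (n + k)
      (\<lambda>y. embed X \<phi> n k (\<lambda>y. \<Psi> n y + \<Xi> n y) y - (\<Psi> (n + k) y + \<Xi> (n + k) y)) < \<epsilon>" .
  qed
qed

lemma cauchy_scale:
  assumes \<Psi>: "\<Psi> \<in> itp_cauchy X \<phi>"
  shows "(\<lambda>n y. a * \<Psi> n y) \<in> itp_cauchy X \<phi>"
  unfolding itp_cauchy_def
proof (safe)
  show "(\<lambda>y. a * \<Psi> n y) \<in> ell2 (cube X n)" for n
    using assms by (intro ell2_scale cauchy_ell2)
  fix \<epsilon> :: real
  assume "\<epsilon> > 0"
  \<comment> \<open>The summand \<open>1\<close> avoids a division by zero for
    \<open>a = 0\<close>.\<close>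
  have pos: "cmod a + 1 > 0" by (simp add: add_nonneg_pos)
  with \<open>\<epsilon> > 0\<close> have \<epsilon>: "\<epsilon> / (cmod a + 1) > 0" by (rule divide_pos_pos)
  obtain N where N: "\<And>n k. n \<ge> N \<Longrightarrow>
      nrm (n + k) (\<lambda>y. embed X \<phi> n k (\<Psi> n) y - \<Psi> (n + k) y) < \<epsilon> / (cmod a + 1)"
    using cauchyD[OF \<Psi> \<epsilon>] by blast
  show "\<exists>N. \<forall>n\<ge>N. \<forall>k. nrm (n + k) (\<lambda>y. embed X \<phi> n k (\<lambda>y. a * \<Psi> n y) y - a * \<Psi> (n + k) y) < \<epsilon>"
  proof (intro exI allI impI)
    fix n k
    assume n: "N \<le> n"
    let ?d = "nrm (n + k) (\<lambda>y. embed X \<phi> n k (\<Psi> n) y - \<Psi> (n + k) y)"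
    have "nrm (n + k) (\<lambda>y. embed X \<phi> n k (\<lambda>y. a * \<Psi> n y) y - a * \<Psi> (n + k) y) = cmod a * ?d"
      unfolding ell2_norm_scale[symmetric] by (simp add: embed_scale right_diff_distrib)
    also have "\<dots> \<le> (cmod a + 1) * ?d"
      by (intro mult_right_mono ell2_norm_nonneg) simp
    also have "\<dots> < \<epsilon>"
      using N[OF n, of k] by (simp only: pos_less_divide_eq[OF pos] mult.commute[of ?d])
    finally show "nrm (n + k) (\<lambda>y. embed X \<phi> n k (\<lambda>y. a * \<Psi> n y) y - a * \<Psi> (n + k) y) < \<epsilon>" .
  qed
qed

text \<open>The connecting maps are isometric, so the norms at two levels differ by at most the
  Cauchy distance of the terms. Hence the \<open>lim\<close> in \<open>itp_norm\<close> is a genuine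
  limit.\<close>

lemma cauchy_norm_convergent:
  assumes \<Psi>: "\<Psi> \<in> itp_cauchy X \<phi>"
  shows "convergent (\<lambda>n. nrm n (\<Psi> n))"
proof (rule Cauchy_convergent, rule CauchyI')
  fix \<epsilon> :: real
  assume \<epsilon>: "\<epsilon> > 0"
  obtain N where N: "\<And>n k. n \<ge> N \<Longrightarrow> nrm (n + k) (\<lambda>y. embed X \<phi> n k (\<Psi> n) y - \<Psi> (n + k) y) < \<epsilon>"
    using cauchyD[OF \<Psi> \<epsilon>] by blast
  show "\<exists>M. \<forall>m\<ge>M. \<forall>n>m. dist (nrm m (\<Psi> m)) (nrm n (\<Psi> n)) < \<epsilon>"
  proof (intro exI allI impI)
    fix m n
    assume "N \<le> m" "m < n"
    then obtain k where n: "n = m + k" using less_imp_add_positive by blast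
    have "\<bar>nrm m (\<Psi> m) - nrm n (\<Psi> n)\<bar> = \<bar>nrm (m + k) (embed X \<phi> m k (\<Psi> m)) - nrm (m + k) (\<Psi> (m + k))\<bar>"
      using embed_ell2[OF cauchy_ell2[OF \<Psi>]] by (simp add: n)
    also have "\<dots> \<le> nrm (m + k) (\<lambda>y. embed X \<phi> m k (\<Psi> m) y - \<Psi> (m + k) y)"
      using \<Psi> by (intro abs_ell2_norm_diff) (auto simp: embed_ell2 cauchy_ell2)
    also have "\<dots> < \<epsilon>" using N \<open>N \<le> m\<close> by blast
    finally show "dist (nrm m (\<Psi> m)) (nrm n (\<Psi> n)) < \<epsilon>" by (simp add: dist_real_def)
  qed
qed

lemma rel_iff: "(\<Psi>, \<Xi>) \<in> itp_rel X \<phi> \<longleftrightarrow> \<Psi> \<in> itp_cauchy X \<phi> \<and> \<Xi> \<in> itp_cauchy X \<phi> \<and>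
    (\<lambda>n. nrm n (\<lambda>y. \<Psi> n y - \<Xi> n y)) \<longlonglongrightarrow> 0"
  by (simp add: itp_rel_def)

lemma nrm_tendsto_0I:
  assumes "\<And>n. nrm n (f n) \<le> g n" "g \<longlonglongrightarrow> 0"
  shows "(\<lambda>n. nrm n (f n)) \<longlonglongrightarrow> 0"
  by (rule tendsto_sandwich[OF _ _ tendsto_const assms(2)]) (auto simp: ell2_norm_nonneg assms(1))

lemma equiv_rel: "equiv (itp_cauchy X \<phi>) (itp_rel X \<phi>)"
proof (rule equivI)
  show "itp_rel X \<phi> \<subseteq> itp_cauchy X \<phi> \<times> itp_cauchy X \<phi>"
    by (auto simp: rel_iff)
  show "refl_on (itp_cauchy X \<phi>) (itp_rel X \<phi>)"
    by (auto simp: refl_on_def rel_iff)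
  show "sym (itp_rel X \<phi>)"
  proof (rule symI)
    fix \<Psi> \<Xi>
    assume a: "(\<Psi>, \<Xi>) \<in> itp_rel X \<phi>"
    have "(\<lambda>n. nrm n (\<lambda>y. \<Xi> n y - \<Psi> n y)) = (\<lambda>n. nrm n (\<lambda>y. \<Psi> n y - \<Xi> n y))"
      by (intro ext ell2_norm_minus_commute)
    with a show "(\<Xi>, \<Psi>) \<in> itp_rel X \<phi>" by (simp only: rel_iff)
  qed
  show "trans (itp_rel X \<phi>)"
  proof (rule transI)
    fix \<Psi> \<Xi> \<Upsilon>
    assume a: "(\<Psi>, \<Xi>) \<in> itp_rel X \<phi>" "(\<Xi>, \<Upsilon>) \<in> itp_rel X \<phi>"
    have "(\<lambda>n. nrm n (\<lambda>y. \<Psi> n y - \<Upsilon> n y)) \<longlonglongrightarrow> 0"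
    proof (rule nrm_tendsto_0I)
      show "nrm n (\<lambda>y. \<Psi> n y - \<Upsilon> n y) \<le> nrm n (\<lambda>y. \<Psi> n y - \<Xi> n y) + nrm n (\<lambda>y. \<Xi> n y - \<Upsilon> n y)" for n
        using a by (intro ell2_norm_diff_triangle) (auto simp: rel_iff cauchy_ell2)
      show "(\<lambda>n. nrm n (\<lambda>y. \<Psi> n y - \<Xi> n y) + nrm n (\<lambda>y. \<Xi> n y - \<Upsilon> n y)) \<longlonglongrightarrow> 0"
        using a by (intro tendsto_add_zero) (simp_all add: rel_iff)
    qed
    with a show "(\<Psi>, \<Upsilon>) \<in> itp_rel X \<phi>" by (simp add: rel_iff)
  qed
qed

lemma class_in_space: "\<Psi> \<in> itp_cauchy X \<phi> \<Longrightarrow> itp_class X \<phi> \<Psi> \<in> itp_space X \<phi>"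
  by (simp add: itp_space_def itp_class_def quotientI)

lemma class_eqI: "(\<Psi>, \<Xi>) \<in> itp_rel X \<phi> \<Longrightarrow> itp_class X \<phi> \<Psi> = itp_class X \<phi> \<Xi>"
  unfolding itp_class_def by (rule equiv_class_eq[OF equiv_rel])

text \<open>Operations on classes are defined through the chosen representative
  \<open>itp_rep\<close>; this relation allows it to be exchanged for any given one.\<close>

lemma rep_class:
  assumes "\<Psi> \<in> itp_cauchy X \<phi>"
  shows "(\<Psi>, itp_rep (itp_class X \<phi> \<Psi>)) \<in> itp_rel X \<phi>"
proof -
  have "\<Psi> \<in> itp_class X \<phi> \<Psi>"
    unfolding itp_class_def by (rule equiv_class_self[OF equiv_rel assms])
  then have "itp_rep (itp_class X \<phi> \<Psi>) \<in> itp_class X \<phi> \<Psi>"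
    unfolding itp_rep_def by (rule someI[of "\<lambda>\<Xi>. \<Xi> \<in> itp_class X \<phi> \<Psi>"])
  then show ?thesis by (simp add: itp_class_def)
qed

lemma space_cases:
  assumes "\<xi> \<in> itp_space X \<phi>"
  obtains \<Psi> where "\<Psi> \<in> itp_cauchy X \<phi>" "\<xi> = itp_class X \<phi> \<Psi>"
  using assms unfolding itp_space_def itp_class_def by (rule quotientE)

lemma rel_add:
  assumes "(\<Psi>, \<Psi>') \<in> itp_rel X \<phi>" "(\<Xi>, \<Xi>') \<in> itp_rel X \<phi>"
  shows "((\<lambda>n y. \<Psi> n y + \<Xi> n y), (\<lambda>n y. \<Psi>' n y + \<Xi>' n y)) \<in> itp_rel X \<phi>"
proof -
  have "(\<lambda>n. nrm n (\<lambda>y. (\<Psi> n y + \<Xi> n y) - (\<Psi>' n y + \<Xi>' n y))) \<longlonglongrightarrow> 0"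
  proof (rule nrm_tendsto_0I)
    fix n
    have "nrm n (\<lambda>y. (\<Psi> n y + \<Xi> n y) - (\<Psi>' n y + \<Xi>' n y)) =
        nrm n (\<lambda>y. (\<Psi> n y - \<Psi>' n y) + (\<Xi> n y - \<Xi>' n y))"
      by (simp add: algebra_simps)
    also have "\<dots> \<le> nrm n (\<lambda>y. \<Psi> n y - \<Psi>' n y) + nrm n (\<lambda>y. \<Xi> n y - \<Xi>' n y)"
      using assms by (intro ell2_norm_triangle ell2_diff) (auto simp: rel_iff cauchy_ell2)
    finally show "nrm n (\<lambda>y. (\<Psi> n y + \<Xi> n y) - (\<Psi>' n y + \<Xi>' n y)) \<le>
        nrm n (\<lambda>y. \<Psi> n y - \<Psi>' n y) + nrm n (\<lambda>y. \<Xi> n y - \<Xi>' n y)" .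
    show "(\<lambda>n. nrm n (\<lambda>y. \<Psi> n y - \<Psi>' n y) + nrm n (\<lambda>y. \<Xi> n y - \<Xi>' n y)) \<longlonglongrightarrow> 0"
      using assms by (intro tendsto_add_zero) (simp_all add: rel_iff)
  qed
  with assms show ?thesis by (simp add: rel_iff cauchy_add)
qed

lemma rel_scale:
  assumes "(\<Psi>, \<Psi>') \<in> itp_rel X \<phi>"
  shows "((\<lambda>n y. a * \<Psi> n y), (\<lambda>n y. a * \<Psi>' n y)) \<in> itp_rel X \<phi>"
proof -
  have "(\<lambda>n. nrm n (\<lambda>y. a * \<Psi> n y - a * \<Psi>' n y)) \<longlonglongrightarrow> 0"
    using assms tendsto_mult_right_zero[of "\<lambda>n. nrm n (\<lambda>y. \<Psi> n y - \<Psi>' n y)" sequentially "cmod a"]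
    by (simp add: rel_iff ell2_norm_scale flip: right_diff_distrib)
  with assms show ?thesis by (simp add: rel_iff cauchy_scale)
qed

lemma plus_class:
  assumes "\<Psi> \<in> itp_cauchy X \<phi>" "\<Xi> \<in> itp_cauchy X \<phi>"
  shows "itp_plus X \<phi> (itp_class X \<phi> \<Psi>) (itp_class X \<phi> \<Xi>) = itp_class X \<phi> (\<lambda>n y. \<Psi> n y + \<Xi> n y)"
  unfolding itp_plus_def using assms by (intro class_eqI[symmetric] rel_add rep_class)

lemma scale_class:
  assumes "\<Psi> \<in> itp_cauchy X \<phi>"
  shows "itp_scale X \<phi> a (itp_class X \<phi> \<Psi>) = itp_class X \<phi> (\<lambda>n y. a * \<Psi> n y)"
  unfolding itp_scale_def using assms by (intro class_eqI[symmetric] rel_scale rep_class)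

text \<open>By the reverse triangle inequality the norms of equivalent sequences differ by a null
  sequence, so any representative computes the norm.\<close>

lemma norm_class:
  assumes "\<Psi> \<in> itp_cauchy X \<phi>"
  shows "(\<lambda>n. nrm n (\<Psi> n)) \<longlonglongrightarrow> itp_norm X (itp_class X \<phi> \<Psi>)"
proof -
  let ?r = "itp_rep (itp_class X \<phi> \<Psi>)"
  have r: "?r \<in> itp_cauchy X \<phi>" "(\<lambda>n. nrm n (\<lambda>y. \<Psi> n y - ?r n y)) \<longlonglongrightarrow> 0"
    using rep_class[OF assms] by (auto simp: rel_iff)
  have lim: "(\<lambda>n. nrm n (?r n)) \<longlonglongrightarrow> itp_norm X (itp_class X \<phi> \<Psi>)"
    using cauchy_norm_convergent[OF r(1)] unfolding itp_norm_def by (simp add: convergent_LIMSEQ_iff)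
  have "(\<lambda>n. nrm n (\<Psi> n) - nrm n (?r n)) \<longlonglongrightarrow> 0"
    by (rule Lim_null_comparison[OF _ r(2)])
      (use assms r(1) in \<open>auto intro!: always_eventually abs_ell2_norm_diff cauchy_ell2\<close>)
  from tendsto_add[OF this lim] show ?thesis by simp
qed

end

section \<open>Infinite tensor products of monomial operators\<close>

text \<open>\<open>monomial\<close> says nothing about values outside \<open>X\<close>; the
  vanishing there is part of \<open>T_phi\<close>. Summability of the distances between
  \<open>T i (\<phi> i)\<close> and \<open>\<phi> i\<close> is the condition from which convergence
  of the tensor product is deduced.\<close>

locale itp_operators = itp +
  fixes T :: "nat \<Rightarrow> ('a \<Rightarrow> complex) \<Rightarrow> 'a \<Rightarrow> complex"
    and c :: "nat \<Rightarrow> 'a \<Rightarrow> complex" and \<sigma> :: "nat \<Rightarrow> 'a \<Rightarrow> 'a"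
  assumes T: "\<forall>i. monomial X (T i) (c i) (\<sigma> i)"
    and T_phi: "\<And>i. T i (\<phi> i) \<in> ell2 X"
    and summable: "summable (\<lambda>i. ell2_norm X (\<lambda>x. T i (\<phi> i) x - \<phi> i x))"
begin

abbreviation defect :: "nat \<Rightarrow> real" where
  "defect i \<equiv> ell2_norm X (\<lambda>x. T i (\<phi> i) x - \<phi> i x)"

text \<open>Moving \<open>T\<close> past the embedding replaces \<open>\<phi>\<close> by its image
  in each of the \<open>k\<close> new factors, one factor at a time, and each replacement costs one
  defect.\<close>

lemma tensor_op_embed:
  assumes \<psi>: "\<psi> \<in> ell2 (cube X n)"
  shows "nrm (n + k) (\<lambda>y. tensor_op X (n + k) T (embed X \<phi> n k \<psi>) y - embed X \<phi> n k (tensor_op X n T \<psi>) y)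
    \<le> nrm n \<psi> * (\<Sum>j<k. defect (n + j))"
proof (induction k)
  case (Suc k)
  define A where "A = tensor_op X (n + k) T (embed X \<phi> n k \<psi>)"
  define B where "B = embed X \<phi> n k (tensor_op X n T \<psi>)"
  have A: "A \<in> ell2 (cube X (n + k))" "nrm (n + k) A = nrm n \<psi>"
    using tensor_op_ell2[OF T] embed_ell2[OF \<psi>] by (auto simp: A_def)
  have B: "B \<in> ell2 (cube X (n + k))"
    using embed_ell2 tensor_op_ell2[OF T \<psi>] by (simp add: B_def)
  define D where "D = (\<lambda>x. T (n + k) (\<phi> (n + k)) x - \<phi> (n + k) x)"
  have D: "D \<in> ell2 X" using T_phi phi by (auto simp: D_def intro: ell2_diff)
  have AB: "(\<lambda>y. A y - B y) \<in> ell2 (cube X (n + k))" using A B by (intro ell2_diff)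
  have "(\<lambda>y. tensor_op X (n + Suc k) T (embed X \<phi> n (Suc k) \<psi>) y -
        embed X \<phi> n (Suc k) (tensor_op X n T \<psi>) y) =
      (\<lambda>y. tensor_vec X (n + k) A (T (n + k) (\<phi> (n + k))) y - tensor_vec X (n + k) B (\<phi> (n + k)) y)"
    by (simp add: tensor_op_tensor_vec[OF T] A_def B_def)
  \<comment> \<open>Telescoping: the first summand has the norm of \<open>\<psi>\<close> times the
    new defect, the second is controlled by the induction hypothesis because
    \<open>\<phi> (n + k)\<close> is a unit vector.\<close>
  also have "\<dots> = (\<lambda>y. tensor_vec X (n + k) A D y + tensor_vec X (n + k) (\<lambda>y. A y - B y) (\<phi> (n + k)) y)"
    by (auto simp: tensor_vec_def D_def fun_eq_iff algebra_simps)
  finally have "nrm (n + Suc k) (\<lambda>y. tensor_op X (n + Suc k) T (embed X \<phi> n (Suc k) \<psi>) y -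
        embed X \<phi> n (Suc k) (tensor_op X n T \<psi>) y) \<le>
      nrm (Suc (n + k)) (tensor_vec X (n + k) A D) +
      nrm (Suc (n + k)) (tensor_vec X (n + k) (\<lambda>y. A y - B y) (\<phi> (n + k)))"
    using ell2_norm_triangle[OF tensor_vec_ell2(1)[OF A(1) D] tensor_vec_ell2(1)[OF AB phi]] by simp
  also have "\<dots> = nrm n \<psi> * ell2_norm X D + nrm (n + k) (\<lambda>y. A y - B y)"
    using tensor_vec_ell2(2)[OF A(1) D] tensor_vec_ell2(2)[OF AB phi] by (simp add: A norm_phi)
  also have "\<dots> \<le> nrm n \<psi> * (\<Sum>j<Suc k. defect (n + j))"
    using Suc.IH by (simp add: A_def B_def D_def algebra_simps)
  finally show ?case .
qed simp

lemma defect_tail: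
  assumes "\<epsilon> > 0"
  obtains N where "\<And>n k. n \<ge> N \<Longrightarrow> (\<Sum>j<k. defect (n + j)) < \<epsilon>"
proof -
  obtain N where N: "\<And>n. n \<ge> N \<Longrightarrow> norm (suminf (\<lambda>i. defect (i + n))) < \<epsilon>"
    using suminf_exist_split[OF assms summable] by blast
  have "(\<Sum>j<k. defect (n + j)) < \<epsilon>" if "n \<ge> N" for n k
  proof -
    have "(\<Sum>j<k. defect (j + n)) \<le> suminf (\<lambda>j. defect (j + n))"
      by (intro sum_le_suminf summable_ignore_initial_segment summable) (auto simp: ell2_norm_nonneg)
    also have "\<dots> < \<epsilon>" using N[OF that] by simp
    finally show ?thesis by (simp add: add.commute)
  qed
  then show ?thesis by (rule that)
qed

lemma op_diff_norm:
  assumes "\<psi> \<in> ell2 (cube X n)" "\<theta> \<in> ell2 (cube X n)"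
  shows "nrm n (\<lambda>y. tensor_op X n T \<psi> y - tensor_op X n T \<theta> y) = nrm n (\<lambda>y. \<psi> y - \<theta> y)"
  using tensor_op_diff[OF T assms] tensor_op_ell2(2)[OF T ell2_diff[OF assms]] by simp

text \<open>Both terms are compared with \<open>T\<close> applied to the embedded
  \<open>\<Psi> n\<close>. One distance is a partial tail of the defects times a bound for the norms
  of \<open>\<Psi>\<close>; the other is, by isometry, the Cauchy distance of \<open>\<Psi>\<close>
  itself.\<close>

lemma cauchy_approx:
  assumes \<Psi>: "\<Psi> \<in> itp_cauchy X \<phi>" and "\<epsilon> > 0"
  obtains N where "\<And>n k. n \<ge> N \<Longrightarrow>
    nrm (n + k) (\<lambda>y. embed X \<phi> n k (tensor_op X n T (\<Psi> n)) y - tensor_op X (n + k) T (\<Psi> (n + k)) y) < \<epsilon>"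
proof -
  obtain B where B: "B > 0" "\<And>n. nrm n (\<Psi> n) \<le> B"
    using convergent_imp_Bseq[OF cauchy_norm_convergent[OF \<Psi>]]
    by (auto simp: Bseq_def ell2_norm_nonneg)
  have pos: "\<epsilon> / (2 * B) > 0" "\<epsilon> / 2 > 0" using \<open>\<epsilon> > 0\<close> B by auto
  obtain N where N: "\<And>n k. n \<ge> N \<Longrightarrow> (\<Sum>j<k. defect (n + j)) < \<epsilon> / (2 * B)"
    using defect_tail[OF pos(1)] by blast
  obtain M where M: "\<And>n k. n \<ge> M \<Longrightarrow> nrm (n + k) (\<lambda>y. embed X \<phi> n k (\<Psi> n) y - \<Psi> (n + k) y) < \<epsilon> / 2"
    using cauchyD[OF \<Psi> pos(2)] by blast
  note e = cauchy_ell2[OF \<Psi>]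
  show ?thesis
  proof (rule that)
    fix n k
    assume n: "max N M \<le> n"
    define E where "E = embed X \<phi> n k (\<Psi> n)"
    have E: "E \<in> ell2 (cube X (n + k))" using embed_ell2[OF e] by (simp add: E_def)
    have E': "embed X \<phi> n k (tensor_op X n T (\<Psi> n)) \<in> ell2 (cube X (n + k))"
      using embed_ell2[OF tensor_op_ell2(1)[OF T e]] by simp
    have "nrm (n + k) (\<lambda>y. embed X \<phi> n k (tensor_op X n T (\<Psi> n)) y - tensor_op X (n + k) T (\<Psi> (n + k)) y)
      \<le> nrm (n + k) (\<lambda>y. embed X \<phi> n k (tensor_op X n T (\<Psi> n)) y - tensor_op X (n + k) T E y)
        + nrm (n + k) (\<lambda>y. tensor_op X (n + k) T E y - tensor_op X (n + k) T (\<Psi> (n + k)) y)"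
      by (intro ell2_norm_diff_triangle E' tensor_op_ell2[OF T] E e)
    also have "\<dots> \<le> nrm n (\<Psi> n) * (\<Sum>j<k. defect (n + j)) + nrm (n + k) (\<lambda>y. E y - \<Psi> (n + k) y)"
      using tensor_op_embed[OF e, of n k] op_diff_norm[OF E e]
      by (subst ell2_norm_minus_commute) (simp flip: E_def)
    also have "\<dots> < B * (\<epsilon> / (2 * B)) + \<epsilon> / 2"
    proof (rule add_le_less_mono)
      show "nrm n (\<Psi> n) * (\<Sum>j<k. defect (n + j)) \<le> B * (\<epsilon> / (2 * B))"
        using n B N[of n k] by (intro mult_mono) (auto simp: ell2_norm_nonneg sum_nonneg less_imp_le)
    qed (use n M in \<open>simp add: E_def\<close>)
    also have "\<dots> = \<epsilon>" using B by (simp add: field_simps)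
    finally show "nrm (n + k)
      (\<lambda>y. embed X \<phi> n k (tensor_op X n T (\<Psi> n)) y - tensor_op X (n + k) T (\<Psi> (n + k)) y) < \<epsilon>" .
  qed
qed

lemma op_cauchy:
  assumes "\<Psi> \<in> itp_cauchy X \<phi>"
  shows "(\<lambda>n. tensor_op X n T (\<Psi> n)) \<in> itp_cauchy X \<phi>"
  unfolding itp_cauchy_def
proof safe
  show "tensor_op X n T (\<Psi> n) \<in> ell2 (cube X n)" for n
    by (intro tensor_op_ell2[OF T] cauchy_ell2 assms)
  show "\<exists>N. \<forall>n\<ge>N. \<forall>k. nrm (n + k) (\<lambda>y. embed X \<phi> n k (tensor_op X n T (\<Psi> n)) y -
      tensor_op X (n + k) T (\<Psi> (n + k)) y) < \<epsilon>" if "\<epsilon> > 0" for \<epsilon>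
    using cauchy_approx[OF assms that] by metis
qed

lemma op_rel:
  assumes "(\<Psi>, \<Xi>) \<in> itp_rel X \<phi>"
  shows "((\<lambda>n. tensor_op X n T (\<Psi> n)), (\<lambda>n. tensor_op X n T (\<Xi> n))) \<in> itp_rel X \<phi>"
  using assms by (simp add: rel_iff op_cauchy op_diff_norm cauchy_ell2)

text \<open>The limit is written down without reference to \<open>J\<close>: at level
  \<open>n\<close> all of the first \<open>n\<close> factors act. That this gives a Cauchy sequence
  is \<open>op_cauchy\<close>.\<close>

definition limit_op :: "'a tensor_seq set \<Rightarrow> 'a tensor_seq set" where
  "limit_op \<xi> = itp_class X \<phi> (\<lambda>n. tensor_op X n T (itp_rep \<xi> n))"

lemma limit_op_class:
  assumes "\<Psi> \<in> itp_cauchy X \<phi>"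
  shows "limit_op (itp_class X \<phi> \<Psi>) = itp_class X \<phi> (\<lambda>n. tensor_op X n T (\<Psi> n))"
  unfolding limit_op_def using assms by (intro class_eqI[symmetric] op_rel rep_class)

lemma bounded_limit_op: "itp_bounded_op X \<phi> limit_op"
  unfolding itp_bounded_op_def
proof (intro conjI ballI allI exI)
  fix \<xi> assume "\<xi> \<in> itp_space X \<phi>"
  then obtain \<Psi> where \<Psi>: "\<Psi> \<in> itp_cauchy X \<phi>" and \<xi>: "\<xi> = itp_class X \<phi> \<Psi>"
    by (rule space_cases)
  show "limit_op \<xi> \<in> itp_space X \<phi>"
    using \<Psi> by (simp add: \<xi> limit_op_class class_in_space op_cauchy)
  show "limit_op (itp_scale X \<phi> a \<xi>) = itp_scale X \<phi> a (limit_op \<xi>)" for a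
    using \<Psi> by (simp add: \<xi> limit_op_class scale_class op_cauchy cauchy_scale
        tensor_op_scale[OF T cauchy_ell2])
  \<comment> \<open>Every level is isometric, so \<open>limit_op\<close> preserves the norm and the
    constant \<open>1\<close> serves.\<close>
  have "(\<lambda>n. nrm n (\<Psi> n)) \<longlonglongrightarrow> itp_norm X (limit_op \<xi>)"
    using norm_class[OF op_cauchy[OF \<Psi>]]
    by (simp add: \<xi> limit_op_class \<Psi> tensor_op_ell2(2)[OF T cauchy_ell2])
  from LIMSEQ_unique[OF this norm_class[OF \<Psi>]]
  show "itp_norm X (limit_op \<xi>) \<le> 1 * itp_norm X \<xi>"
    by (simp add: \<xi>)
  fix \<eta> assume "\<eta> \<in> itp_space X \<phi>"
  then obtain \<Xi> where \<Xi>: "\<Xi> \<in> itp_cauchy X \<phi>" and \<eta>: "\<eta> = itp_class X \<phi> \<Xi>"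
    by (rule space_cases)
  show "limit_op (itp_plus X \<phi> \<xi> \<eta>) = itp_plus X \<phi> (limit_op \<xi>) (limit_op \<eta>)"
    using \<Psi> \<Xi> by (simp add: \<xi> \<eta> limit_op_class plus_class op_cauchy cauchy_add
        tensor_op_add[OF T cauchy_ell2 cauchy_ell2])
qed

text \<open>Identity factors have defect \<open>0\<close>, so the criterion is inherited and
  everything shown for \<open>T\<close> also applies to the operators acting only in the factors of
  \<open>J\<close>.\<close>

lemma restricted_operators:
  "itp_operators X \<phi> (\<lambda>i. if i \<in> J then T i else (\<lambda>f. f))
    (\<lambda>i. if i \<in> J then c i else (\<lambda>y. 1)) (\<lambda>i. if i \<in> J then \<sigma> i else (\<lambda>y. y))"
proof
  show "summable (\<lambda>i. ell2_norm X (\<lambda>x. (if i \<in> J then T i else (\<lambda>f. f)) (\<phi> i) x - \<phi> i x))"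
    by (rule summable_comparison_test'[OF summable]) (auto simp: ell2_norm_nonneg)
qed (auto simp: T T_phi phi monomial_id)

lemma op_exists: "itp_op_exists X \<phi> T"
  unfolding itp_op_exists_def
proof (intro exI conjI ballI)
  show "itp_bounded_op X \<phi> limit_op" by (rule bounded_limit_op)
  fix \<xi> assume "\<xi> \<in> itp_space X \<phi>"
  then obtain \<Psi>0 where "\<Psi>0 \<in> itp_cauchy X \<phi>" and \<xi>: "\<xi> = itp_class X \<phi> \<Psi>0"
    by (rule space_cases)
  \<comment> \<open>This is the representative that \<open>itp_op\<close> and
    \<open>limit_op\<close> themselves pick, so both unfold to the same
    \<open>\<Psi>\<close>.\<close>
  define \<Psi> where "\<Psi> = itp_rep \<xi>"
  have \<Psi>: "\<Psi> \<in> itp_cauchy X \<phi>"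
    using rep_class[OF \<open>\<Psi>0 \<in> _\<close>] by (simp add: \<Psi>_def \<xi> rel_iff)
  note e = cauchy_ell2[OF \<Psi>]
  define TJ where "TJ J = (\<lambda>i. if i \<in> J then T i else (\<lambda>f. f))" for J
  have op: "itp_op X \<phi> T J \<xi> = itp_class X \<phi> (\<lambda>n. tensor_op X n (TJ J) (\<Psi> n))" for J
    by (simp add: itp_op_def TJ_def \<Psi>_def)
  have lop: "limit_op \<xi> = itp_class X \<phi> (\<lambda>n. tensor_op X n T (\<Psi> n))"
    by (simp add: limit_op_def \<Psi>_def)
  show "((\<lambda>J. itp_norm X (itp_plus X \<phi> (itp_op X \<phi> T J \<xi>) (itp_scale X \<phi> (- 1) (limit_op \<xi>)))) \<longlongrightarrow> 0)
          (finite_subsets_at_top UNIV)"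
  proof (rule tendstoI)
    fix \<epsilon> :: real
    assume "\<epsilon> > 0"
    obtain B where B: "B > 0" "\<And>n. nrm n (\<Psi> n) \<le> B"
      using convergent_imp_Bseq[OF cauchy_norm_convergent[OF \<Psi>]]
      by (auto simp: Bseq_def ell2_norm_nonneg)
    \<comment> \<open>Four errors of at most \<open>\<epsilon> / 8\<close> are added below; their
      sum \<open>\<epsilon> / 2\<close> remains strictly below \<open>\<epsilon>\<close> after the
      passage to the limit in \<open>n\<close>.\<close>
    have pos: "\<epsilon> / (8 * B) > 0" "\<epsilon> / 8 > 0" using \<open>\<epsilon> > 0\<close> B by auto
    obtain N1 where N1: "\<And>n k. n \<ge> N1 \<Longrightarrow> (\<Sum>j<k. defect (n + j)) < \<epsilon> / (8 * B)"
      using defect_tail[OF pos(1)] by blast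
    obtain N2 where N2: "\<And>n k. n \<ge> N2 \<Longrightarrow> nrm (n + k) (\<lambda>y. embed X \<phi> n k (\<Psi> n) y - \<Psi> (n + k) y) < \<epsilon> / 8"
      using cauchyD[OF \<Psi> pos(2)] by blast
    define N where "N = max N1 N2"
    have close: "itp_norm X (itp_plus X \<phi> (itp_op X \<phi> T J \<xi>) (itp_scale X \<phi> (- 1) (limit_op \<xi>))) \<le> \<epsilon> / 2 \<and>
        0 \<le> itp_norm X (itp_plus X \<phi> (itp_op X \<phi> T J \<xi>) (itp_scale X \<phi> (- 1) (limit_op \<xi>)))"
      if J: "{..<N} \<subseteq> J" for J
    proof -
      interpret J: itp_operators X \<phi> "TJ J" "\<lambda>i. if i \<in> J then c i else (\<lambda>y. 1)"
        "\<lambda>i. if i \<in> J then \<sigma> i else (\<lambda>y. y)"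
        unfolding TJ_def by (rule restricted_operators)
      define W where "W = (\<lambda>n y. tensor_op X n (TJ J) (\<Psi> n) y + (- 1) * tensor_op X n T (\<Psi> n) y)"
      have W: "W \<in> itp_cauchy X \<phi>"
        unfolding W_def by (intro cauchy_add cauchy_scale op_cauchy J.op_cauchy \<Psi>)
      have cW: "itp_plus X \<phi> (itp_op X \<phi> T J \<xi>) (itp_scale X \<phi> (- 1) (limit_op \<xi>)) = itp_class X \<phi> W"
        unfolding W_def
        by (simp only: op lop scale_class[OF op_cauchy[OF \<Psi>]]
            plus_class[OF J.op_cauchy[OF \<Psi>] cauchy_scale[OF op_cauchy[OF \<Psi>]]])
      have lim: "(\<lambda>n. nrm n (W n)) \<longlonglongrightarrow> itp_norm X (itp_class X \<phi> W)"
        by (rule norm_class[OF W])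
      have bound: "nrm (N + k) (W (N + k)) \<le> \<epsilon> / 2" for k
      proof -
        let ?m = "N + k"
        define E where "E = embed X \<phi> N k (\<Psi> N)"
        define F where "F = embed X \<phi> N k (tensor_op X N T (\<Psi> N))"
        have E: "E \<in> ell2 (cube X ?m)" using embed_ell2[OF e] by (simp add: E_def)
        have F: "F \<in> ell2 (cube X ?m)"
          using embed_ell2[OF tensor_op_ell2(1)[OF T e]] by (simp add: F_def)
        \<comment> \<open>Below \<open>N\<close> the two families agree because \<open>J\<close>
          contains \<open>{..<N}\<close>, so \<open>F\<close> is a common comparison vector for both
          operators.\<close>
        have F': "F = embed X \<phi> N k (tensor_op X N (TJ J) (\<Psi> N))"
          unfolding F_def using J by (subst tensor_op_cong[of N "TJ J" T]) (auto simp: TJ_def)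
        have d: "J.defect i \<le> defect i" for i
          by (simp add: TJ_def ell2_norm_nonneg)
        have "(\<Sum>j<k. J.defect (N + j)) \<le> (\<Sum>j<k. defect (N + j))"
          by (intro sum_mono d)
        also have "\<dots> < \<epsilon> / (8 * B)" by (rule N1) (simp add: N_def)
        finally have sums: "(\<Sum>j<k. J.defect (N + j)) < \<epsilon> / (8 * B)" "(\<Sum>j<k. defect (N + j)) < \<epsilon> / (8 * B)"
          using N1[of N k] by (auto simp: N_def)
        have small: "nrm N (\<Psi> N) * s \<le> \<epsilon> / 8" if "0 \<le> s" "s < \<epsilon> / (8 * B)" for s
        proof -
          have "nrm N (\<Psi> N) * s \<le> B * (\<epsilon> / (8 * B))"
            using that B by (intro mult_mono) (auto simp: ell2_norm_nonneg)
          then show ?thesis using B by simp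
        qed
        have approx: "nrm ?m (\<lambda>y. E y - \<Psi> ?m y) < \<epsilon> / 8"
          unfolding E_def by (rule N2) (simp add: N_def)
        have 1: "nrm ?m (\<lambda>y. tensor_op X ?m (TJ J) E y - F y) \<le> \<epsilon> / 8"
          unfolding F' E_def
          by (rule order_trans[OF J.tensor_op_embed[OF e] small]) (auto simp: sums sum_nonneg ell2_norm_nonneg)
        have 2: "nrm ?m (\<lambda>y. tensor_op X ?m T E y - F y) \<le> \<epsilon> / 8"
          unfolding F_def E_def
          by (rule order_trans[OF tensor_op_embed[OF e] small]) (auto simp: sums sum_nonneg ell2_norm_nonneg)
        have 3: "nrm ?m (\<lambda>y. tensor_op X ?m (TJ J) E y - tensor_op X ?m (TJ J) (\<Psi> ?m) y) < \<epsilon> / 8"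
          using approx by (simp add: J.op_diff_norm[OF E e])
        have 4: "nrm ?m (\<lambda>y. tensor_op X ?m T E y - tensor_op X ?m T (\<Psi> ?m) y) < \<epsilon> / 8"
          using approx by (simp add: op_diff_norm[OF E e])
        note t = tensor_op_ell2(1)[OF T] tensor_op_ell2(1)[OF J.T]
        \<comment> \<open>The path leads from the image of \<open>\<Psi> ?m\<close> under
          \<open>TJ J\<close> through that of \<open>E\<close> to \<open>F\<close>, then through the
          image of \<open>E\<close> under \<open>T\<close> to that of
          \<open>\<Psi> ?m\<close>.\<close>
        have "nrm ?m (\<lambda>y. tensor_op X ?m (TJ J) (\<Psi> ?m) y - tensor_op X ?m T (\<Psi> ?m) y) \<le>
            nrm ?m (\<lambda>y. tensor_op X ?m (TJ J) (\<Psi> ?m) y - F y) + nrm ?m (\<lambda>y. F y - tensor_op X ?m T (\<Psi> ?m) y)"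
          by (intro ell2_norm_diff_triangle t e F)
        also have "nrm ?m (\<lambda>y. tensor_op X ?m (TJ J) (\<Psi> ?m) y - F y) \<le> \<epsilon> / 8 + \<epsilon> / 8"
          using ell2_norm_diff_triangle[OF t(2)[OF e] t(2)[OF E] F] 1 3
          by (simp add: ell2_norm_minus_commute[of _ "tensor_op X ?m (TJ J) (\<Psi> ?m)"])
        also have "nrm ?m (\<lambda>y. F y - tensor_op X ?m T (\<Psi> ?m) y) \<le> \<epsilon> / 8 + \<epsilon> / 8"
          using ell2_norm_diff_triangle[OF F t(1)[OF E] t(1)[OF e]] 2 4
          by (simp add: ell2_norm_minus_commute[of _ F])
        finally show ?thesis by (simp add: W_def)
      qed
      have "itp_norm X (itp_class X \<phi> W) \<le> \<epsilon> / 2"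
      proof (rule LIMSEQ_le_const2[OF lim])
        show "\<exists>N. \<forall>n\<ge>N. nrm n (W n) \<le> \<epsilon> / 2"
          using bound by (metis le_add_diff_inverse)
      qed
      moreover have "0 \<le> itp_norm X (itp_class X \<phi> W)"
        by (rule LIMSEQ_le_const[OF lim]) (auto simp: ell2_norm_nonneg)
      ultimately show ?thesis by (simp add: cW)
    qed
    show "\<forall>\<^sub>F J in finite_subsets_at_top UNIV.
        dist (itp_norm X (itp_plus X \<phi> (itp_op X \<phi> T J \<xi>) (itp_scale X \<phi> (- 1) (limit_op \<xi>)))) 0 < \<epsilon>"
      unfolding eventually_finite_subsets_at_top
    proof (intro exI[of _ "{..<N}"] conjI allI impI)
      fix J assume "finite J \<and> {..<N} \<subseteq> J \<and> J \<subseteq> (UNIV :: nat set)"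
      then show "dist (itp_norm X (itp_plus X \<phi> (itp_op X \<phi> T J \<xi>) (itp_scale X \<phi> (- 1) (limit_op \<xi>)))) 0 < \<epsilon>"
        using close[of J] \<open>\<epsilon> > 0\<close> by (simp add: dist_real_def)
    qed auto
  qed
qed

end

section \<open>Almost invariant vectors and the theorem\<close>

lemma mean_sum:
  fixes m :: "('g \<Rightarrow> real) \<Rightarrow> real" and f :: "'i \<Rightarrow> 'g \<Rightarrow> real"
  assumes add: "\<And>f g. bounded (f ` A) \<Longrightarrow> bounded (g ` A) \<Longrightarrow> m (\<lambda>y. f y + g y) = m f + m g"
    and zero: "m (\<lambda>y. 0) = 0"
    and "finite F" "\<And>x. x \<in> F \<Longrightarrow> bounded (f x ` A)"
  shows "bounded ((\<lambda>g. \<Sum>x\<in>F. f x g) ` A) \<and> m (\<lambda>g. \<Sum>x\<in>F. f x g) = (\<Sum>x\<in>F. m (f x))"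
  using assms(3,4)
proof (induction F rule: finite_induct)
  case empty
  have "(\<lambda>g. 0::real) ` A \<subseteq> {0}" by auto
  then show ?case using zero by (auto intro: bounded_subset[of "{0}"])
next
  case (insert x F)
  then have "bounded (f x ` A)" "bounded ((\<lambda>g. \<Sum>x\<in>F. f x g) ` A)" by auto
  from bounded_plus_comp[OF this] add[OF this] insert show ?case by simp
qed

text \<open>The mean annihilates the difference of a bounded function and its translate, so a finite
  sum of such differences has mean \<open>0\<close> and cannot be bounded below by a positive
  constant.\<close>

lemma amenable_no_strict_increase:
  fixes G (structure) and h :: "'g \<Rightarrow> 'g \<Rightarrow> real"
  assumes "group G" "amenable G" "finite F" "F \<subseteq> carrier G"
    and h: "\<And>x y. \<bar>h x y\<bar> \<le> 1"
    and ge: "\<And>g. g \<in> carrier G \<Longrightarrow> \<epsilon> \<le> (\<Sum>x\<in>F. h x (x \<otimes> g) - h x g)"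
  shows "\<epsilon> \<le> 0"
proof -
  interpret group G by fact
  obtain m :: "('g \<Rightarrow> real) \<Rightarrow> real" where
    add: "\<And>f g. bounded (f ` carrier G) \<Longrightarrow> bounded (g ` carrier G) \<Longrightarrow>
        m (\<lambda>y. f y + g y) = m f + m g" and
    scale: "\<And>c f. bounded (f ` carrier G) \<Longrightarrow> m (\<lambda>y. c * f y) = c * m f" and
    pos: "\<And>f. bounded (f ` carrier G) \<Longrightarrow> \<forall>y\<in>carrier G. 0 \<le> f y \<Longrightarrow> 0 \<le> m f" and
    one: "m (\<lambda>y. 1) = 1" and
    inv: "\<And>x f. x \<in> carrier G \<Longrightarrow> bounded (f ` carrier G) \<Longrightarrow> m (\<lambda>y. f (inv x \<otimes> y)) = m f"
    using \<open>amenable G\<close> unfolding amenable_def by blast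
  have bdd_const: "bounded ((\<lambda>y. c) ` carrier G)" for c :: real
    by (rule boundedI[of _ "\<bar>c\<bar>"]) auto
  have const: "m (\<lambda>y. c) = c" for c
    using scale[OF bdd_const, of c 1] one by simp
  have bdd: "bounded (h x ` S)" "bounded ((\<lambda>g. h x (x \<otimes> g)) ` S)" for x S
    using h by (auto intro!: boundedI[of _ 1])
  have bdd_minus: "bounded ((\<lambda>g. (-1) * h x g) ` S)" for x S
    using h by (auto intro!: boundedI[of _ 1])
  have bdd_diff: "bounded ((\<lambda>g. h x (x \<otimes> g) - h x g) ` carrier G)" for x
    by (rule bounded_minus_comp[OF bdd(2) bdd(1)])
  have diff: "m (\<lambda>g. h x (x \<otimes> g) - h x g) = 0" if x: "x \<in> carrier G" for x
  proof -
    have "m (\<lambda>g. h x (x \<otimes> g) + (-1) * h x g) = m (\<lambda>g. h x (x \<otimes> g)) + m (\<lambda>g. (-1) * h x g)"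
      by (rule add[OF bdd(2) bdd_minus])
    \<comment> \<open>Invariance is formulated with \<open>inv x\<close>, so it is used here at the
      inverse of \<open>x\<close>.\<close>
    moreover have "m (\<lambda>g. h x (x \<otimes> g)) = m (h x)"
      using inv[of "inv x" "h x"] x bdd(1) by simp
    moreover have "m (\<lambda>g. (-1) * h x g) = (-1) * m (h x)"
      by (rule scale[OF bdd(1)])
    ultimately show ?thesis by simp
  qed
  let ?f = "\<lambda>g. \<Sum>x\<in>F. h x (x \<otimes> g) - h x g"
  have sum: "bounded (?f ` carrier G) \<and> m ?f = (\<Sum>x\<in>F. m (\<lambda>g. h x (x \<otimes> g) - h x g))"
    by (rule mean_sum[OF add const \<open>finite F\<close> bdd_diff])
  have "m ?f = 0"
    using sum diff \<open>F \<subseteq> carrier G\<close> by (auto intro: sum.neutral)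
  moreover have "m (\<lambda>g. ?f g + (- \<epsilon>)) = m ?f + m (\<lambda>g. - \<epsilon>)"
    using sum bdd_const by (intro add) auto
  moreover have "0 \<le> m (\<lambda>g. ?f g + (- \<epsilon>))"
    using ge by (intro pos bounded_plus_comp[OF conjunct1[OF sum] bdd_const]) simp
  ultimately show ?thesis using const[of "- \<epsilon>"] by simp
qed

lemma l1_norm_single: "l1_norm (Poly_Mapping.single i 1) = 1"
  by (simp add: l1_norm_def)

text \<open>All \<open>x\<close> in \<open>F\<close> are treated simultaneously by working with
  finitely supported functions on pairs, one copy of the l1 space of the group for each
  \<open>x\<close>. A separating functional would contradict
  \<open>amenable_no_strict_increase\<close>.\<close>

lemma amenable_almost_invariant_distribution:
  fixes G (structure)
  assumes "group G" "amenable G" "finite F" "F \<subseteq> carrier G" "\<epsilon> > 0"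
  obtains A and p :: "'g \<Rightarrow> real" where
    "finite A" "A \<subseteq> carrier G" "\<And>g. g \<notin> A \<Longrightarrow> p g = 0" "\<And>g. 0 \<le> p g" "sum p A = 1"
    "\<And>x B. x \<in> F \<Longrightarrow> finite B \<Longrightarrow> B \<subseteq> carrier G \<Longrightarrow> (\<Sum>y\<in>B. \<bar>p (inv x \<otimes> y) - p y\<bar>) < \<epsilon>"
proof -
  interpret group G by fact
  define s :: "'g \<Rightarrow> 'g \<Rightarrow> ('g \<times> 'g) \<Rightarrow>\<^sub>0 real" where "s x y = Poly_Mapping.single (x, y) 1" for x y
  \<comment> \<open>In the copy belonging to \<open>x\<close> in \<open>F\<close>,
    \<open>d g\<close> is the difference of the point masses at \<open>x \<otimes> g\<close> and
    \<open>g\<close>; its convex combinations therefore encode \<open>x p - p\<close> for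
    distributions \<open>p\<close>.\<close>
  define d where "d g = (\<Sum>x\<in>F. s x (x \<otimes> g) - s x g)" for g
  have "\<exists>k\<in>convex hull (d ` carrier G). l1_norm k < \<epsilon>"
  proof (rule ccontr)
    assume "\<not> ?thesis"
    then have ge: "\<epsilon> \<le> l1_norm k" if "k \<in> convex hull (d ` carrier G)" for k
      using that by (meson not_le)
    have ne: "convex hull (d ` carrier G) \<noteq> {}"
      using one_closed by (auto simp del: one_closed)
    obtain l where l: "linear l" "\<And>w. l w \<le> l1_norm w" "\<And>k. k \<in> convex hull (d ` carrier G) \<Longrightarrow> \<epsilon> \<le> l k"
      using separate_convex_from_seminorm_ball[OF l1_norm_add l1_norm_scaleR convex_convex_hull ne ge]
      by metis
    \<comment> \<open>Domination by \<open>l1_norm\<close> for both signs makes \<open>l\<close>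
      bounded on point masses, so it yields bounded functions on the group.\<close>
    have "\<bar>l (s x y)\<bar> \<le> 1" for x y
      using l(2)[of "s x y"] l(2)[of "- s x y"] l1_norm_scaleR[of "-1" "s x y"] linear_neg[OF l(1), of "s x y"]
      by (simp add: s_def l1_norm_single)
    moreover have "\<epsilon> \<le> (\<Sum>x\<in>F. l (s x (x \<otimes> g)) - l (s x g))" if "g \<in> carrier G" for g
      using l(3)[of "d g"] that hull_inc[of "d g" "d ` carrier G" convex]
      by (simp add: d_def linear_sum[OF l(1)] linear_diff[OF l(1)])
    ultimately have "\<epsilon> \<le> 0"
      using amenable_no_strict_increase[OF assms(1-4), of "\<lambda>x y. l (s x y)" \<epsilon>] by blast
    with \<open>\<epsilon> > 0\<close> show False by simp
  qed
  then obtain S u where S: "finite S" "S \<subseteq> d ` carrier G" "\<And>v. v \<in> S \<Longrightarrow> 0 \<le> u v" "sum u S = 1"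
    and small: "l1_norm (\<Sum>v\<in>S. u v *\<^sub>R v) < \<epsilon>"
    unfolding convex_hull_explicit by auto
  \<comment> \<open>\<open>d\<close> may identify group elements; one preimage is chosen for each
    point of \<open>S\<close>, so that the weights become a distribution on the group.\<close>
  obtain A where A: "A \<subseteq> carrier G" "inj_on d A" "S = d ` A"
    using S(2) by (auto simp: subset_image_inj)
  have "finite A" using S(1) A by (simp add: finite_image_iff)
  define p where "p g = (if g \<in> A then u (d g) else 0)" for g
  define k where "k = (\<Sum>v\<in>S. u v *\<^sub>R v)"
  have k: "k = (\<Sum>g\<in>A. p g *\<^sub>R d g)"
    unfolding k_def A(3) sum.reindex[OF A(2)] by (intro sum.cong) (auto simp: p_def)
  have lookup_d: "Poly_Mapping.lookup (d g) (x, y) = (if g = inv x \<otimes> y then 1 else 0) - (if g = y then 1 else 0)"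
    if "x \<in> F" "g \<in> carrier G" "y \<in> carrier G" for x y g
  proof -
    have x: "x \<in> carrier G" using that(1) assms(4) by blast
    have "x \<otimes> g = y \<longleftrightarrow> g = inv x \<otimes> y"
      using inv_solve_left[of g x y] x that by auto
    then have eq: "Poly_Mapping.lookup (s x' (x' \<otimes> g) - s x' g) (x, y) =
        (if x' = x then (if g = inv x \<otimes> y then 1 else 0) - (if g = y then 1 else 0) else 0)" for x'
      by (auto simp: lookup_minus s_def lookup_single when_def)
    show ?thesis
      unfolding d_def lookup_sum eq using that(1) \<open>finite F\<close> by simp
  qed
  have lookup_k: "Poly_Mapping.lookup k (x, y) = p (inv x \<otimes> y) - p y"
    if "x \<in> F" "y \<in> carrier G" for x y
  proof -
    have "Poly_Mapping.lookup k (x, y) =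
        (\<Sum>g\<in>A. (if g = inv x \<otimes> y then p g else 0) - (if g = y then p g else 0))"
      unfolding k lookup_sum using that A(1)
      by (intro sum.cong) (auto simp: lookup_scaleR lookup_d subset_iff)
    also have "\<dots> = p (inv x \<otimes> y) - p y"
      using \<open>finite A\<close> by (simp add: sum_subtractf) (simp add: p_def)
    finally show ?thesis .
  qed
  show ?thesis
  proof (rule that[of A p])
    show "0 \<le> p g" for g using S(3) A(3) by (simp add: p_def)
    show "sum p A = 1"
      using S(4) unfolding A(3) sum.reindex[OF A(2)] by (simp add: p_def)
    fix x B
    assume x: "x \<in> F" "finite B" "B \<subseteq> carrier G"
    \<comment> \<open>Only the copy belonging to \<open>x\<close> is summed here; the remaining
      indices can only increase the full norm.\<close>
    have "(\<Sum>y\<in>B. \<bar>p (inv x \<otimes> y) - p y\<bar>) = (\<Sum>i\<in>{x} \<times> B. \<bar>Poly_Mapping.lookup k i\<bar>)"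
      using x unfolding sum.cartesian_product[symmetric]
      by (auto intro!: sum.cong simp: lookup_k subset_iff sum.cartesian_product')
    also have "\<dots> \<le> l1_norm k"
      using x by (intro sum_abs_le_l1_norm) simp
    finally show "(\<Sum>y\<in>B. \<bar>p (inv x \<otimes> y) - p y\<bar>) < \<epsilon>"
      using small by (simp add: k_def)
  qed (use \<open>finite A\<close> A(1) in \<open>auto simp: p_def\<close>)
qed

text \<open>The difference of the roots is in modulus at most their sum, and the product of the two
  is \<open>a - b\<close>. This turns l1-closeness of distributions into l2-closeness of their
  square roots.\<close>

lemma sqrt_diff_square_le:
  assumes "0 \<le> a" "0 \<le> b"
  shows "(sqrt a - sqrt b)\<^sup>2 \<le> \<bar>a - b\<bar>"
proof -
  have "(sqrt a - sqrt b)\<^sup>2 = \<bar>sqrt a - sqrt b\<bar> * \<bar>sqrt a - sqrt b\<bar>"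
    by (simp add: power2_eq_square)
  also have "\<dots> \<le> \<bar>sqrt a - sqrt b\<bar> * \<bar>sqrt a + sqrt b\<bar>"
    using real_sqrt_ge_zero[OF assms(1)] real_sqrt_ge_zero[OF assms(2)]
    by (intro mult_left_mono) linarith+
  also have "\<dots> = \<bar>a - b\<bar>"
    using assms unfolding abs_mult[symmetric] by (simp add: algebra_simps)
  finally show ?thesis .
qed

text \<open>The constant cocycle \<open>1\<close> makes \<open>left_regular\<close> plain
  translation; the twist is dealt with separately.\<close>

lemma amenable_almost_invariant_vector:
  fixes G (structure)
  assumes "group G" "amenable G" "finite F" "F \<subseteq> carrier G" "\<epsilon> > 0"
  obtains A and f :: "'g \<Rightarrow> complex" where
    "finite A" "A \<subseteq> carrier G" "\<And>g. g \<notin> A \<Longrightarrow> f g = 0" "f \<in> ell2 (carrier G)" "ell2_norm (carrier G) f = 1"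
    "\<And>x. x \<in> F \<Longrightarrow> ell2_norm (carrier G) (\<lambda>y. left_regular G (\<lambda>_ _. 1) x f y - f y) \<le> \<epsilon>"
proof -
  \<comment> \<open>The squared l2 distance of the roots is bounded by the l1 distance, hence the
    tolerance \<open>\<epsilon>\<^sup>2\<close>.\<close>
  have "\<epsilon>\<^sup>2 > 0" using assms(5) by simp
  from amenable_almost_invariant_distribution[OF assms(1-4) this]
  obtain A and p :: "'g \<Rightarrow> real" where A: "finite A" "A \<subseteq> carrier G"
    and p: "\<And>g. g \<notin> A \<Longrightarrow> p g = 0" "\<And>g. 0 \<le> p g" "sum p A = 1"
    and small: "\<And>x B. x \<in> F \<Longrightarrow> finite B \<Longrightarrow> B \<subseteq> carrier G \<Longrightarrow>
      (\<Sum>y\<in>B. \<bar>p (inv x \<otimes> y) - p y\<bar>) < \<epsilon>\<^sup>2"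
    by blast
  define f where "f g = complex_of_real (sqrt (p g))" for g
  have f2: "(cmod (f g))\<^sup>2 = p g" for g
    using p(2) by (simp add: f_def)
  have "(\<lambda>g. (cmod (f g))\<^sup>2) summable_on carrier G \<longleftrightarrow> (\<lambda>g. (cmod (f g))\<^sup>2) summable_on A"
    using A p(1) by (intro summable_on_cong_neutral) (auto simp: f2)
  then have f: "f \<in> ell2 (carrier G)"
    using A p(1) by (auto simp: ell2_def f_def)
  have "(\<Sum>\<^sub>\<infinity>g\<in>carrier G. (cmod (f g))\<^sup>2) = (\<Sum>\<^sub>\<infinity>g\<in>A. (cmod (f g))\<^sup>2)"
    using A p(1) by (intro infsum_cong_neutral) (auto simp: f2)
  then have norm: "ell2_norm (carrier G) f = 1"
    using A p(3) by (simp add: ell2_norm_def f2)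
  show ?thesis
  proof (rule that[OF A _ f norm])
    show "f g = 0" if "g \<notin> A" for g using p(1)[OF that] by (simp add: f_def)
    fix x assume x: "x \<in> F"
    show "ell2_norm (carrier G) (\<lambda>y. left_regular G (\<lambda>_ _. 1) x f y - f y) \<le> \<epsilon>"
    proof (rule ell2_bounded_L2_set)
      show "left_regular G (\<lambda>_ _. 1) x f y - f y = 0" if "y \<notin> carrier G" for y
        using that A p(1) by (auto simp: left_regular_def f_def)
      fix B assume B: "finite B" "B \<subseteq> carrier G"
      have "(\<Sum>y\<in>B. (cmod (left_regular G (\<lambda>_ _. 1) x f y - f y))\<^sup>2) \<le> (\<Sum>y\<in>B. \<bar>p (inv x \<otimes> y) - p y\<bar>)"
      proof (rule sum_mono)
        fix y assume "y \<in> B"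
        then have "left_regular G (\<lambda>_ _. 1) x f y - f y = of_real (sqrt (p (inv x \<otimes> y)) - sqrt (p y))"
          using B by (auto simp: left_regular_def f_def)
        then show "(cmod (left_regular G (\<lambda>_ _. 1) x f y - f y))\<^sup>2 \<le> \<bar>p (inv x \<otimes> y) - p y\<bar>"
          using sqrt_diff_square_le[OF p(2) p(2)] by (simp only: norm_of_real power2_abs)
      qed
      also have "\<dots> \<le> \<epsilon>\<^sup>2" using small[OF x B] by simp
      finally show "L2_set (\<lambda>y. cmod (left_regular G (\<lambda>_ _. 1) x f y - f y)) B \<le> \<epsilon>"
        unfolding L2_set_def using \<open>\<epsilon> > 0\<close> by (simp add: real_le_lsqrt)
    qed
  qed
qed

section \<open>Cocycles close to 1 and the choice of the subsequence\<close>

text \<open>Adjoining a new index \<open>j\<close> to a late finite set \<open>J\<close> multiplies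
  the product by \<open>v j x y\<close>. The product over \<open>J\<close> has modulus
  \<open>1\<close>, so the change has size exactly \<open>cmod (v j x y - 1)\<close>.\<close>

lemma product_sequence_tendsto_1:
  fixes G (structure)
  assumes v: "product_sequence G v" and x: "x \<in> carrier G" "y \<in> carrier G"
  shows "(\<lambda>j. v j x y) \<longlonglongrightarrow> 1"
proof (rule LIMSEQ_I)
  fix \<epsilon> :: real
  assume "\<epsilon> > 0"
  have unit: "cmod (v j x y) = 1" for j
    using assms by (auto simp: product_sequence_def cocycles2_def)
  obtain L where "((\<lambda>J. \<Prod>i\<in>J. v i x y) \<longlongrightarrow> L) (finite_subsets_at_top UNIV)"
    using assms unfolding product_sequence_def by blast
  then have "\<forall>\<^sub>F J in finite_subsets_at_top UNIV. dist (\<Prod>i\<in>J. v i x y) L < \<epsilon> / 2"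
    using \<open>\<epsilon> > 0\<close> by (intro tendstoD) auto
  then obtain J where J: "finite J" "\<And>J'. finite J' \<Longrightarrow> J \<subseteq> J' \<Longrightarrow> dist (\<Prod>i\<in>J'. v i x y) L < \<epsilon> / 2"
    unfolding eventually_finite_subsets_at_top by auto
  obtain N where N: "\<And>j. j \<in> J \<Longrightarrow> j < N"
    using J(1) by (meson finite_nat_set_iff_bounded)
  have "norm (v j x y - 1) < \<epsilon>" if "j \<ge> N" for j
  proof -
    have j: "j \<notin> J" using N that by (meson not_le)
    let ?P = "\<Prod>i\<in>J. v i x y"
    have "cmod ?P = 1" by (simp add: unit flip: prod_norm)
    then have "norm (v j x y - 1) = cmod (v j x y * ?P - ?P)"
      by (metis mult.right_neutral left_diff_distrib mult_1 norm_mult)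
    also have "\<dots> = dist (\<Prod>i\<in>insert j J. v i x y) ?P"
      using j J(1) by (simp add: dist_norm)
    also have "\<dots> \<le> dist (\<Prod>i\<in>insert j J. v i x y) L + dist ?P L"
      by (rule dist_triangle2)
    also have "\<dots> < \<epsilon>"
      using J(2)[of "insert j J", OF _ subset_insertI] J(2)[of J] J(1) by auto
    finally show ?thesis .
  qed
  then show "\<exists>N. \<forall>j\<ge>N. norm (v j x y - 1) < \<epsilon>" by blast
qed

lemma monomial_left_regular:
  fixes G (structure)
  assumes "group G" "x \<in> carrier G" "\<And>y. y \<in> carrier G \<Longrightarrow> cmod (u y x) = 1"
  shows "monomial (carrier G) (left_regular G u x) (\<lambda>y. u (inv y) x) (\<lambda>y. inv x \<otimes> y)"
proof -
  interpret group G by fact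
  have "bij_betw (\<lambda>y. inv x \<otimes> y) (carrier G) (carrier G)"
    by (rule bij_betw_byWitness[where f' = "\<lambda>y. x \<otimes> y"])
      (use assms(2) in \<open>auto simp: m_assoc[symmetric]\<close>)
  then show ?thesis
    using assms by (simp add: monomial_def left_regular_def)
qed

lemma monomial_ell2:
  assumes "monomial X T c \<sigma>" "f \<in> ell2 X" "\<And>y. y \<notin> X \<Longrightarrow> T f y = 0"
  shows "T f \<in> ell2 X" "ell2_norm X (T f) = ell2_norm X f"
  using ell2_monomial[of f X \<sigma> c "T f"] assms by (auto simp: monomial_def)

lemma ell2_norm_mono:
  assumes "g \<in> ell2 A" "\<And>x. x \<notin> A \<Longrightarrow> f x = 0" "\<And>x. x \<in> A \<Longrightarrow> cmod (f x) \<le> cmod (g x)"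
  shows "ell2_norm A f \<le> ell2_norm A g"
proof (rule ell2_bounded_L2_set(2)[OF assms(2)])
  fix B assume B: "finite B" "B \<subseteq> A"
  have "L2_set (\<lambda>x. cmod (f x)) B \<le> L2_set (\<lambda>x. cmod (g x)) B"
    using B assms(3) by (intro L2_set_mono) auto
  also have "\<dots> \<le> ell2_norm A g" by (rule L2_set_le_ell2_norm[OF assms(1) B])
  finally show "L2_set (\<lambda>x. cmod (f x)) B \<le> ell2_norm A g" .
qed

text \<open>The untwisted translate is the intermediate vector: the phase matters only where the
  translate of \<open>f\<close> is nonzero and changes it by at most \<open>\<epsilon>\<close> in
  norm, and translation itself moves \<open>f\<close> by at most \<open>\<epsilon>\<close>.\<close>

lemma left_regular_defect:
  fixes G (structure)
  assumes "group G" "x \<in> carrier G" "f \<in> ell2 (carrier G)" "ell2_norm (carrier G) f = 1"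
    and u: "\<And>y. y \<in> carrier G \<Longrightarrow> cmod (u y x) = 1"
    and close: "\<And>y. y \<in> carrier G \<Longrightarrow> f (inv x \<otimes> y) \<noteq> 0 \<Longrightarrow> cmod (u (inv y) x - 1) \<le> \<epsilon>"
    and "0 \<le> \<epsilon>"
    and inv: "ell2_norm (carrier G) (\<lambda>y. left_regular G (\<lambda>_ _. 1) x f y - f y) \<le> \<epsilon>"
  shows "ell2_norm (carrier G) (\<lambda>y. left_regular G u x f y - f y) \<le> 2 * \<epsilon>"
proof -
  have out: "left_regular G w x f y = 0" if "y \<notin> carrier G" for w y
    using that by (simp add: left_regular_def)
  note U = monomial_ell2[OF monomial_left_regular[of G x u, OF assms(1,2) u] assms(3) out]
  have "monomial (carrier G) (left_regular G (\<lambda>_ _. 1) x) (\<lambda>y. 1) (\<lambda>y. inv x \<otimes> y)"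
    using monomial_left_regular[of G x "\<lambda>_ _. 1"] assms(1,2) by simp
  note V = monomial_ell2[OF this assms(3) out]
  have "ell2_norm (carrier G) (\<lambda>y. left_regular G u x f y - left_regular G (\<lambda>_ _. 1) x f y)
      \<le> ell2_norm (carrier G) (\<lambda>y. of_real \<epsilon> * left_regular G (\<lambda>_ _. 1) x f y)"
  proof (rule ell2_norm_mono)
    show "(\<lambda>y. of_real \<epsilon> * left_regular G (\<lambda>_ _. 1) x f y) \<in> ell2 (carrier G)"
      by (rule ell2_scale[OF V(1)])
    fix y assume y: "y \<in> carrier G"
    have "left_regular G u x f y - left_regular G (\<lambda>_ _. 1) x f y = (u (inv y) x - 1) * f (inv x \<otimes> y)"
      using y by (simp add: left_regular_def algebra_simps)
    moreover have "cmod (u (inv y) x - 1) * cmod (f (inv x \<otimes> y)) \<le> \<epsilon> * cmod (f (inv x \<otimes> y))"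
      using close[OF y] by (cases "f (inv x \<otimes> y) = 0") (auto intro: mult_right_mono)
    ultimately show "cmod (left_regular G u x f y - left_regular G (\<lambda>_ _. 1) x f y)
        \<le> cmod (of_real \<epsilon> * left_regular G (\<lambda>_ _. 1) x f y)"
      using y \<open>0 \<le> \<epsilon>\<close> by (simp add: norm_mult left_regular_def)
  qed (simp add: out)
  also have "\<dots> = \<epsilon>"
    using V(2) assms(4,7) by (simp add: ell2_norm_scale)
  finally show ?thesis
    using ell2_norm_diff_triangle[OF U(1) V(1) assms(3)] inv by simp
qed

theorem corollary3p4:
  fixes G :: "('g, 'b) monoid_scheme"
    and v :: "nat \<Rightarrow> 'g \<Rightarrow> 'g \<Rightarrow> complex"
  assumes "group G"
    and "carrier G \<noteq> {\<one>\<^bsub>G\<^esub>}"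
    and "countable (carrier G)"
    and "amenable G"
    and "product_sequence G v"
  shows "\<exists>(r :: nat \<Rightarrow> nat) (\<phi> :: nat \<Rightarrow> 'g \<Rightarrow> complex).
           strict_mono r \<and>
           (\<forall>i. \<phi> i \<in> ell2 (carrier G) \<and> ell2_norm (carrier G) (\<phi> i) = 1) \<and>
           (\<forall>x\<in>carrier G.
              itp_op_exists (carrier G) \<phi> (\<lambda>i. left_regular G (v (r i)) x))"
proof -
  interpret group G by fact
  define e where "e = from_nat_into (carrier G)"
  have e: "range e = carrier G"
    unfolding e_def using assms(3) by (intro range_from_nat_into) auto
  \<comment> \<open>For a finite group the enumeration \<open>e\<close> repeats elements; what
    matters is that the sets \<open>F i\<close> increase and exhaust the carrier.\<close>
  define F where "F i = e ` {..i}" for i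
  have F: "finite (F i)" "F i \<subseteq> carrier G" for i
    using e by (auto simp: F_def)
  \<comment> \<open>The vectors are chosen before the subsequence, as they depend only on the group.
    Their finite supports leave finitely many cocycle values to control for each
    \<open>i\<close>.\<close>
  define good where "good i A f \<longleftrightarrow> finite A \<and> A \<subseteq> carrier G \<and> (\<forall>g. g \<notin> A \<longrightarrow> f g = 0) \<and>
      f \<in> ell2 (carrier G) \<and> ell2_norm (carrier G) f = 1 \<and>
      (\<forall>x\<in>F i. ell2_norm (carrier G) (\<lambda>y. left_regular G (\<lambda>_ _. 1) x f y - f y) \<le> (1/2)^i)"
    for i A and f :: "'g \<Rightarrow> complex"
  have "\<exists>A f. good i A f" for i
    unfolding good_def
    by (rule amenable_almost_invariant_vector[OF assms(1,4) F, of "(1/2)^i" i]) (simp, blast)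
  then obtain A \<phi> where good: "\<And>i. good i (A i) (\<phi> i)" by metis
  have A: "\<And>i. finite (A i)" "\<And>i. A i \<subseteq> carrier G"
    and \<phi>: "\<And>i g. g \<notin> A i \<Longrightarrow> \<phi> i g = 0" "\<And>i. \<phi> i \<in> ell2 (carrier G)" "\<And>i. ell2_norm (carrier G) (\<phi> i) = 1"
    and inv: "\<And>i x. x \<in> F i \<Longrightarrow>
      ell2_norm (carrier G) (\<lambda>y. left_regular G (\<lambda>_ _. 1) x (\<phi> i) y - \<phi> i y) \<le> (1/2)^i"
    using good unfolding good_def by blast+
  \<comment> \<open>The phase of \<open>left_regular\<close> at \<open>y\<close> is
    \<open>v j (inv y) x\<close>, and it matters only at points \<open>y = x \<otimes> a\<close>
    with \<open>a\<close> in \<open>A i\<close>.\<close>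
  have "\<forall>\<^sub>F j in sequentially. \<forall>x\<in>F i. \<forall>a\<in>A i. cmod (v j (inv\<^bsub>G\<^esub> (x \<otimes>\<^bsub>G\<^esub> a)) x - 1) < (1/2)^i" for i
  proof (intro eventually_ball_finite F A ballI)
    fix x a assume "x \<in> F i" "a \<in> A i"
    then have "(\<lambda>j. v j (inv\<^bsub>G\<^esub> (x \<otimes>\<^bsub>G\<^esub> a)) x) \<longlonglongrightarrow> 1"
      using F A by (intro product_sequence_tendsto_1[OF assms(5)]) blast+
    from tendstoD[OF this, of "(1/2)^i"]
    show "\<forall>\<^sub>F j in sequentially. cmod (v j (inv\<^bsub>G\<^esub> (x \<otimes>\<^bsub>G\<^esub> a)) x - 1) < (1/2)^i"
      by (simp add: dist_norm)
  qed
  then obtain N where N: "\<And>i j x a. j \<ge> N i \<Longrightarrow> x \<in> F i \<Longrightarrow> a \<in> A i \<Longrightarrow>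
      cmod (v j (inv\<^bsub>G\<^esub> (x \<otimes>\<^bsub>G\<^esub> a)) x - 1) < (1/2)^i"
    unfolding eventually_sequentially by metis
  \<comment> \<open>The sum dominates \<open>N i\<close>, and the summand \<open>i\<close> makes
    \<open>r\<close> strictly increasing.\<close>
  define r where "r i = i + (\<Sum>k\<le>i. N k)" for i
  have r: "strict_mono r"
    by (rule strict_mono_Suc_iff[THEN iffD2]) (simp add: r_def)
  have rN: "N i \<le> r i" for i
    using member_le_sum[of i "{..i}" N] by (simp add: r_def)
  have "itp_op_exists (carrier G) \<phi> (\<lambda>i. left_regular G (v (r i)) x)" if x: "x \<in> carrier G" for x
  proof -
    have unit: "cmod (v j y x) = 1" if "y \<in> carrier G" for j y
      using assms(5) that x by (auto simp: product_sequence_def cocycles2_def)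
    obtain n where n: "x = e n" using x e by blast
    have mono: "monomial (carrier G) (left_regular G (v (r i)) x)
        (\<lambda>y. v (r i) (inv\<^bsub>G\<^esub> y) x) (\<lambda>y. inv\<^bsub>G\<^esub> x \<otimes>\<^bsub>G\<^esub> y)" for i
      by (intro monomial_left_regular assms(1) x unit)
    \<comment> \<open>From \<open>n\<close> on, \<open>x\<close> belongs to \<open>F i\<close>; the
      finitely many earlier defects do not affect summability.\<close>
    have defect: "ell2_norm (carrier G) (\<lambda>y. left_regular G (v (r i)) x (\<phi> i) y - \<phi> i y) \<le> 2 * (1/2)^i"
      if "i \<ge> n" for i
    proof (rule left_regular_defect[where u = "v (r i)", OF assms(1) x \<phi>(2,3) unit])
      have xF: "x \<in> F i" using that by (auto simp: n F_def)
      then show "ell2_norm (carrier G) (\<lambda>y. left_regular G (\<lambda>_ _. 1) x (\<phi> i) y - \<phi> i y) \<le> (1/2)^i"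
        by (rule inv)
      fix y assume y: "y \<in> carrier G" "\<phi> i (inv\<^bsub>G\<^esub> x \<otimes>\<^bsub>G\<^esub> y) \<noteq> 0"
      then have "inv\<^bsub>G\<^esub> x \<otimes>\<^bsub>G\<^esub> y \<in> A i" using \<phi>(1) by blast
      from N[OF rN xF this] show "cmod (v (r i) (inv\<^bsub>G\<^esub> y) x - 1) \<le> (1/2)^i"
        using x y by (simp flip: m_assoc)
    qed auto
    interpret itp_operators "carrier G" \<phi> "\<lambda>i. left_regular G (v (r i)) x"
      "\<lambda>i y. v (r i) (inv\<^bsub>G\<^esub> y) x" "\<lambda>i y. inv\<^bsub>G\<^esub> x \<otimes>\<^bsub>G\<^esub> y"
    proof
      show "summable (\<lambda>i. ell2_norm (carrier G) (\<lambda>y. left_regular G (v (r i)) x (\<phi> i) y - \<phi> i y))"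
      proof (rule summable_comparison_test')
        show "summable (\<lambda>i. 2 * (1/2)^i :: real)" by (intro summable_mult summable_geometric) simp
        show "norm (ell2_norm (carrier G) (\<lambda>y. left_regular G (v (r i)) x (\<phi> i) y - \<phi> i y)) \<le> 2 * (1/2)^i"
          if "n \<le> i" for i
          using defect[OF that] by (simp add: ell2_norm_nonneg)
      qed
      show "left_regular G (v (r i)) x (\<phi> i) \<in> ell2 (carrier G)" for i
        by (rule monomial_ell2(1)[OF mono \<phi>(2)]) (simp add: left_regular_def)
    qed (use mono \<phi> in auto)
    show ?thesis by (rule op_exists)
  qed
  with r \<phi> show ?thesis by blast
qed

end
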